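(* Let $n \ge 10$ and let $\ell$ be a positive integer with $2\ell \le n$. Let $K_n=([n],E_n)$ be the complete graph and let $P^\ell_{\mathrm{match}}(n) \subseteq \mathbb{R}^{E_n}$ be the convex hull of the characteristic vectors of all matchings of $K_n$ with exactly $\ell$ edges. Let the alternating group $A_n$ act on $\mathbb{R}^{E_n}$ by permuting coordinates according to its action on the vertices (hence on the edges) of $K_n$. If $Q \subseteq \mathbb{R}^d$ is a symmetric extension of $P^\ell_{\mathrm{match}}(n)$ with respect to $A_n$, then $Q$ has at least $\binom{n}{\lfloor (\ell-1)/2\rfloor}$ facets.
   Context: A symmetric extension of an $A_n$-invariant polytope $P\subseteq\mathbb{R}^m$ with respect to $A_n$ is a polytope $Q\subseteq\mathbb{R}^d$ invariant under some affine action of $A_n$ on $\mathbb{R}^d$, together with a linear map $p\colon \mathbb{R}^d\to\mathbb{R}^m$ such that $p(Q)=P$ and $p(gx)=g\,p(x)$ for all $g\in A_n$, $x\in Q$. *)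

theory Defs
  imports "HOL-Analysis.Analysis" "HOL-Algebra.Sym_Groups" "HOL-Algebra.Group_Action"
begin

definition affine_map :: "('a::real_vector \<Rightarrow> 'b::real_vector) \<Rightarrow> bool" where
  "affine_map f \<longleftrightarrow> (\<exists>L b. linear L \<and> (\<forall>x. f x = L x + b))"

definition affine_action ::
    "('g, 'm) monoid_scheme \<Rightarrow> ('g \<Rightarrow> 'a::real_vector \<Rightarrow> 'a) \<Rightarrow> bool" where
  "affine_action G \<phi> \<longleftrightarrow> group_action G UNIV \<phi> \<and> (\<forall>g\<in>carrier G. affine_map (\<phi> g))"

text \<open>The argument \<open>\<psi>\<close> is the given action of \<open>G\<close> on the ambient space of \<open>P\<close>;
  the action \<open>\<phi>\<close> on the ambient space of \<open>Q\<close> and the projection \<open>p\<close> are part of the data of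
  the extension.\<close>

definition symmetric_extension ::
    "('g, 'm) monoid_scheme \<Rightarrow> ('g \<Rightarrow> 'b::euclidean_space \<Rightarrow> 'b) \<Rightarrow> 'b set
      \<Rightarrow> 'a::euclidean_space set \<Rightarrow> bool" where
  "symmetric_extension G \<psi> P Q \<longleftrightarrow>
     polytope Q \<and>
     (\<exists>\<phi> p. affine_action G \<phi> \<and> (\<forall>g\<in>carrier G. \<phi> g ` Q = Q) \<and>
            linear p \<and> p ` Q = P \<and>
            (\<forall>g\<in>carrier G. \<forall>x\<in>Q. p (\<phi> g x) = \<psi> g (p x)))"

definition complete_edges :: "nat \<Rightarrow> nat set set" where
  "complete_edges n = {e. e \<subseteq> {1..n} \<and> card e = 2}"

definition matching :: "nat \<Rightarrow> nat set set \<Rightarrow> bool" where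
  "matching n M \<longleftrightarrow> M \<subseteq> complete_edges n \<and> pairwise disjnt M"

text \<open>The space of real vectors indexed by the edges of the complete graph on \<open>{1..n}\<close> is
  rendered as \<open>real ^ 'e\<close>, where \<open>ends :: 'e \<Rightarrow> nat set\<close> is a bijection from the index type
  \<open>'e\<close> onto \<open>complete_edges n\<close>.\<close>

definition char_vector :: "('e::finite \<Rightarrow> nat set) \<Rightarrow> nat set set \<Rightarrow> real ^ 'e" where
  "char_vector ends M = (\<chi> e. if ends e \<in> M then 1 else 0)"

definition matching_polytope :: "('e::finite \<Rightarrow> nat set) \<Rightarrow> nat \<Rightarrow> nat \<Rightarrow> (real ^ 'e) set" where
  "matching_polytope ends n l =
     convex hull {char_vector ends M | M. matching n M \<and> card M = l}"

text \<open>Left action by coordinate permutation: the coordinate of \<open>\<pi> \<cdot> x\<close> at an edge is the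
  coordinate of \<open>x\<close> at the preimage of that edge under \<open>\<pi>\<close>.\<close>

definition edge_action ::
    "('e::finite \<Rightarrow> nat set) \<Rightarrow> (nat \<Rightarrow> nat) \<Rightarrow> real ^ 'e \<Rightarrow> real ^ 'e" where
  "edge_action ends \<pi> x = (\<chi> e. x $ (inv_into UNIV ends (\<pi> -` ends e)))"

end

theory Submission
  imports Defs "HOL-Computational_Algebra.Polynomial"
begin

text \<open>
  Let \<open>k = (l - 1) div 2\<close> and suppose that \<open>Q\<close> has fewer than \<open>n choose k\<close> facets.  The stabiliser
  of a facet in the alternating group then has index less than \<open>n choose k\<close>, and such a subgroup contains
  all even permutations fixing some set \<open>T\<close> of at most \<open>k\<close> points.  Choose for every matching \<open>M\<close> a
  point \<open>s M \<in> Q\<close> above its characteristic vector, equivariantly.  The slack of \<open>s M\<close> with respect to the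
  facet depends only on the edges of \<open>M\<close> meeting \<open>T\<close>.

  Fix disjoint vertex sets \<open>V\<close>, \<open>W\<close> of size \<open>2 * k + 1\<close>.  For functions depending only on the edges at
  \<open>k\<close> vertices, the average over the perfect matchings of \<open>V \<union> W\<close> with \<open>i\<close> edges between \<open>V\<close> and \<open>W\<close>
  is a polynomial in \<open>i\<close> of degree at most \<open>k\<close>, so it can be extrapolated from the possible values
  \<open>i = 1, 3, \<dots>, 2 * k + 1\<close> to \<open>i = 0\<close>, and the extrapolation preserves nonnegativity.  The
  corresponding affine combination of the points \<open>s M\<close> satisfies all facet inequalities and hence lies in \<open>Q\<close>,
  but its image has total weight \<open>k + 1 / 2\<close> on the edges inside \<open>V\<close>, whereas a matching has at
  most \<open>k\<close> such edges.
\<close>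

section \<open>Binomial estimates\<close>

text \<open>The sizes are dictated by parity. As \<open>2 * k + 1\<close> is odd, no perfect
  matching of \<open>V \<union> W\<close> has \<open>0\<close> crossing edges, and the
  \<open>k + 1\<close> odd values are just enough to determine a polynomial of degree
  \<open>k\<close>. A matching with \<open>i\<close> crossing edges has
  \<open>(2 * k + 1 - i) / 2\<close> edges inside \<open>V\<close>, whence the impossible value
  \<open>k + 1 / 2\<close> at \<open>i = 0\<close>. The extrapolation weights may be negative, so
  nonnegativity at \<open>0\<close> cannot come from averaging; a recursion carries it along while
  the vertices of \<open>T\<close> are removed one by one. The subgroups of small index are
  classified by order estimates. On a large orbit, the relation of lying in a common three-cycle of
  the group has one class (then all even permutations of the orbit are present), or singleton
  classes (Bochert's bound), or proper blocks (an imprimitive group). \<open>n \<ge> 10\<close>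
  keeps that orbit at \<open>8\<close> points or more, where the numerical estimates are available.
  Only even permutations may move one matching to another; a wrong sign is repaired by swapping the
  ends of an edge away from \<open>T\<close>, which leaves the matching unchanged.\<close>

lemma binomial_step_double:
  assumes "3 * k + 2 \<le> n"
  shows "2 * (n choose k) \<le> n choose Suc k"
proof -
  have "Suc k * (n choose Suc k) = (n - k) * (n choose k)"
    by (metis binomial_absorb_comp binomial_absorption mult.commute)
  moreover have "2 * Suc k \<le> n - k" using assms by simp
  ultimately have "2 * Suc k * (n choose k) \<le> Suc k * (n choose Suc k)"
    by (metis mult_le_mono1)
  hence "Suc k * (2 * (n choose k)) \<le> Suc k * (n choose Suc k)"
    by (simp only: ac_simps)
  thus ?thesis by (metis mult_le_cancel1 zero_less_Suc)
qed

text \<open>Two steps up from \<open>s \<ge> 1\<close> in row \<open>N\<close> already multiply by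
  \<open>4\<close>. The constant is \<open>2 * fact 2\<close>, as needed for partitions into two
  interchangeable blocks.\<close>

lemma four_binomial_le_central:
  assumes "N \<ge> 8" "4 * s + 2 \<le> N"
  shows "4 * (N choose s) \<le> N choose (N div 2)"
proof -
  have main: "4 * (N choose s) \<le> N choose (N div 2)" if s: "s \<ge> 1" "4 * s + 2 \<le> N" for s
  proof -
    have 1: "Suc s * (N choose Suc s) = (N - s) * (N choose s)" for s
      by (metis binomial_absorb_comp binomial_absorption mult.commute)
    have "Suc (Suc s) * Suc s * (N choose Suc (Suc s)) = (N - Suc s) * (N - s) * (N choose s)"
      using 1[of s] 1[of "Suc s"] by (metis mult.assoc mult.left_commute)
    moreover have "4 * (Suc (Suc s) * Suc s) \<le> (N - Suc s) * (N - s)"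
    \<comment> \<open>At \<open>s = 1\<close> the bound \<open>4 * s + 2 \<le> N\<close> alone
      yields only \<open>4 * 5 < 24\<close>; there \<open>N \<ge> 8\<close> is used instead.\<close>
    proof (cases "s = 1")
      case True
      have "6 * 7 \<le> (N - Suc s) * (N - s)" using True assms by (intro mult_le_mono) auto
      thus ?thesis using True by simp
    next
      case False
      have "(3 * s + 1) * (3 * s + 2) \<le> (N - Suc s) * (N - s)"
        using s by (intro mult_le_mono) auto
      moreover obtain u where "s = u + 2" using s False by (metis add.commute le_Suc_ex One_nat_def Suc_1 antisym not_less_eq_eq)
      hence "4 * (Suc (Suc s) * Suc s) \<le> (3 * s + 1) * (3 * s + 2)" by (simp add: algebra_simps)
      ultimately show ?thesis by linarith
    qed
    ultimately have "4 * (Suc (Suc s) * Suc s) * (N choose s) \<le> Suc (Suc s) * Suc s * (N choose Suc (Suc s))"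
      by (metis mult_le_mono1)
    hence "(Suc (Suc s) * Suc s) * (4 * (N choose s)) \<le> Suc (Suc s) * Suc s * (N choose Suc (Suc s))"
      by (simp only: ac_simps)
    hence "4 * (N choose s) \<le> N choose Suc (Suc s)" by (simp only: mult_le_cancel1) simp
    also have "\<dots> \<le> N choose (N div 2)" using s by (intro binomial_mono) auto
    finally show ?thesis .
  qed
  show ?thesis
  proof (cases "s = 0")
    case True
    have "4 * (N choose 0) \<le> 4 * (N choose 1)" using assms by simp
    thus ?thesis using main[of 1] assms True by simp
  qed (use main assms in auto)
qed

lemma double_binomial_le_pow2:
  assumes "r \<ge> 1" shows "2 * (r choose q) \<le> 2 ^ r"
proof -
  obtain n where r: "r = Suc n" using assms by (cases r) auto
  have "r choose q \<le> 2 ^ n"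
  proof (cases q)
    case (Suc p)
    show ?thesis
    proof (cases "p < n")
      case True
      have "r choose q = (\<Sum>i\<in>{p, Suc p}. n choose i)" by (simp add: r Suc)
      also have "\<dots> \<le> (\<Sum>i\<le>n. n choose i)" using True by (intro sum_mono2) auto
      finally show ?thesis by (simp add: choose_row_sum)
    next
      case False
      thus ?thesis using r Suc by (cases "p = n") (auto simp: binomial_eq_0)
    qed
  qed simp
  thus ?thesis using r by simp
qed

lemma four_pow_le_fact: "m \<ge> 9 \<Longrightarrow> 4 ^ m \<le> (fact m :: nat)"
proof (induction m rule: nat_induct_at_least)
  case base show ?case by (simp add: fact_numeral)
next
  case (Suc m)
  have "4 ^ Suc m = 4 * (4 ^ m :: nat)" by simp
  also have "\<dots> \<le> Suc m * fact m" using Suc by (intro mult_le_mono) auto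
  finally show ?case by simp
qed

lemma double_binomial_le_fact_half:
  assumes "N \<ge> 8" "4 * s + 2 \<le> N"
  shows "2 * (N choose s) \<le> fact (N - N div 2)"
\<comment> \<open>From \<open>17\<close> on the factorial has argument at least \<open>9\<close>,
  where \<open>4 ^ m \<le> fact m\<close> sets in. The nine smaller values are checked at the
  largest possible \<open>s\<close>, namely \<open>(N - 2) div 4\<close>.\<close>
proof (cases "N \<ge> 17")
  case True
  have "2 * (N choose s) \<le> 2 ^ N" using True by (intro double_binomial_le_pow2) simp
  also have "\<dots> \<le> 2 ^ (2 * (N - N div 2))" by (intro power_increasing) auto
  also have "\<dots> = (4::nat) ^ (N - N div 2)" by (simp add: power_mult)
  also have "\<dots> \<le> fact (N - N div 2)" using True by (intro four_pow_le_fact) simp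
  finally show ?thesis .
next
  case False
  have "N \<in> {8,9,10,11,12,13,14,15,16}" using False assms(1) by auto
  moreover have "N choose s \<le> N choose ((N - 2) div 4)"
    using assms by (intro binomial_mono) auto
  moreover have "2 * (N choose ((N - 2) div 4)) \<le> fact (N - N div 2)" 
  proof -
    have "14 choose 3 = (364::nat)" "15 choose 3 = (455::nat)" "16 choose 3 = (560::nat)"
      by (simp_all add: numeral_eq_Suc)
    thus ?thesis using calculation(1) by (auto simp: fact_numeral choose_two)
  qed
  ultimately show ?thesis by linarith
qed

text \<open>The constant is \<open>6 choose 2\<close>. It covers both later needs:
  \<open>2 ^ 2 * fact 2 = 8\<close> for two blocks and \<open>2 * fact 3 = 12\<close> for
  three.\<close>

lemma central_binomial_ge_15:
  assumes "d \<ge> 3" shows "15 * (fact d * fact d) \<le> (fact (2 * d) :: nat)"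
proof -
  have f: "(fact (2 * d) :: nat) = (2 * d choose d) * (fact d * fact d)"
    using binomial_fact_lemma[of d "2 * d"] by (simp add: ac_simps mult_2)
  have "15 \<le> 2 * d choose 2"
  proof -
    have "2 * d choose 2 = d * (2 * d - 1)" by (simp add: choose_two)
    moreover have "3 * 5 \<le> d * (2 * d - 1)" using assms by (intro mult_le_mono) auto
    ultimately show ?thesis by simp
  qed
  also have "\<dots> \<le> 2 * d choose d" using assms by (intro binomial_mono) auto
  finally show ?thesis unfolding f by (rule mult_le_mono1)
qed

lemma fact_eq_binomial_mult: "q \<le> r \<Longrightarrow> (fact r :: nat) = (r choose q) * (fact q * fact (r - q))"
  using binomial_fact_lemma[of q r] by (simp add: ac_simps)

text \<open>The quotient \<open>fact (j * d) / (fact j * fact d ^ j)\<close> counts the partitions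
  of \<open>j * d\<close> points into \<open>j\<close> blocks of size \<open>d\<close>. A further
  block multiplies it by \<open>(Suc j * d choose d) / Suc j\<close>, which is at least
  \<open>2\<close>. A single block has only one partition, hence the start at
  \<open>j = 2\<close>.\<close>

lemma fact_blocks_ge_pow2:
  assumes "d \<ge> 3" "j \<ge> 2"
  shows "2 ^ j * (fact j * fact d ^ j) \<le> (fact (j * d) :: nat)"
  using assms(2)
proof (induction j rule: nat_induct_at_least)
  case base
  have "2 ^ 2 * (fact 2 * fact d ^ 2) \<le> 15 * (fact d * fact d :: nat)"
    by (simp add: power2_eq_square)
  also have "\<dots> \<le> fact (2 * d)" by (rule central_binomial_ge_15[OF assms(1)])
  finally show ?case .
next
  case (Suc j)
  have "2 * Suc j \<le> Suc j * d choose d"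
  proof -
    have "2 * Suc j \<le> Suc j * d" 
      using mult_le_mono2[of 2 d "Suc j"] assms(1) by (simp only: mult.commute)
    also have "\<dots> = Suc j * d choose 1" by simp
    also have "\<dots> \<le> Suc j * d choose d"
    proof -
      have "2 * d \<le> Suc j * d" using Suc.hyps by (intro mult_le_mono) auto
      thus ?thesis using assms(1) by (intro binomial_mono) auto
    qed
    finally show ?thesis .
  qed
  hence "(2 * Suc j) * (fact d * (2 ^ j * (fact j * fact d ^ j)))
      \<le> (Suc j * d choose d) * (fact d * fact (j * d))"
    using Suc.IH by (intro mult_le_mono) auto
  also have "\<dots> = fact (Suc j * d)" using fact_eq_binomial_mult[of d "Suc j * d"] by simp
  finally show ?case by (simp add: algebra_simps)
qed

text \<open>Splitting the blocks into two halves gives the factor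
  \<open>r * d choose (q * d)\<close>, which dominates \<open>r * d choose s\<close>; partitioning
  the halves gives \<open>2 ^ q * 2 ^ (r - q)\<close>, which pays for
  \<open>2 * (r choose q)\<close>. For \<open>r = 2\<close> and \<open>r = 3\<close> one half is a
  single block and contributes no power of \<open>2\<close>, so these cases use the central
  coefficient directly.\<close>

lemma double_binomial_le_equipartitions:
  assumes "r \<ge> 2" "d \<ge> 3" "r * d \<ge> 8" "4 * s + 2 \<le> r * d"
  shows "2 * (r * d choose s) * (fact r * fact d ^ r) \<le> (fact (r * d) :: nat)"
proof -
  define q where "q = r div 2"
  have q: "q \<le> r" "q * d \<le> r * d" by (auto simp: q_def)
  have split: "fact (r * d) = (r * d choose (q * d)) * (fact (q * d) * fact ((r - q) * d) :: nat)"
    using fact_eq_binomial_mult[OF q(2)] by (simp add: diff_mult_distrib)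
  consider "r = 2" | "r = 3" | "r \<ge> 4" using assms(1) by linarith
  thus ?thesis
  proof cases
    case 1
    have "4 * (2 * d choose s) \<le> 2 * d choose d"
      using four_binomial_le_central[of "2 * d" s] assms 1 by simp
    from mult_le_mono1[OF this, of "fact d * fact d"] show ?thesis
      using split 1 by (simp add: q_def power2_eq_square ac_simps)
  next
    case 2
    have "3 * d choose s \<le> 3 * d choose d"
      using assms 2 by (intro binomial_mono) auto
    hence "(3 * d choose s) * (fact d * (15 * (fact d * fact d))) \<le> (3 * d choose d) * (fact d * fact (2 * d))"
      using central_binomial_ge_15[OF assms(2)] by (intro mult_le_mono) auto
    moreover have "2 * (3 * d choose s) * (fact 3 * fact d ^ 3)
        \<le> (3 * d choose s) * (fact d * (15 * (fact d * fact d)))"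
      by (simp add: power3_eq_cube fact_numeral)
    moreover have "fact (3 * d) = (3 * d choose d) * (fact d * fact (2 * d) :: nat)"
      using split 2 by (simp add: q_def)
    ultimately show ?thesis unfolding 2 by (simp only:)
  next
    case 3
    have q2: "q \<ge> 2" "r - q \<ge> 2" using 3 by (auto simp: q_def)
    have qd: "s \<le> q * d" "2 * (q * d) \<le> r * d"
    proof -
      have "r \<le> 4 * q" using 3 by (auto simp: q_def)
      hence "r * d \<le> 4 * (q * d)" using mult_le_mono1[of r "4 * q" d] by (simp only: mult.assoc)
      thus "s \<le> q * d" using assms by linarith
      have "2 * q \<le> r" by (auto simp: q_def)
      from mult_le_mono1[OF this, of d] show "2 * (q * d) \<le> r * d" by simp
    qed
    have p: "(2::nat) ^ r = 2 ^ q * 2 ^ (r - q)" "fact d ^ r = fact d ^ q * (fact d ^ (r - q) :: nat)"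
      using q(1) by (simp_all flip: power_add)
    have "2 * (r * d choose s) * (fact r * fact d ^ r)
      = (r * d choose s) * (2 * (r choose q)) * (fact q * fact d ^ q * (fact (r - q) * fact d ^ (r - q)))"
      using fact_eq_binomial_mult[OF q(1)] p by (simp add: ac_simps)
    also have "\<dots> \<le> (r * d choose (q * d)) * 2 ^ r * (fact q * fact d ^ q * (fact (r - q) * fact d ^ (r - q)))"
      using mult_le_mono[OF binomial_mono[OF qd] double_binomial_le_pow2] 3
      by (intro mult_le_mono1) auto
    also have "\<dots> = (r * d choose (q * d)) * ((2 ^ q * (fact q * fact d ^ q)) * (2 ^ (r - q) * (fact (r - q) * fact d ^ (r - q))))"
      using p by (simp add: ac_simps)
    also have "\<dots> \<le> (r * d choose (q * d)) * (fact (q * d) * fact ((r - q) * d))"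
      using q2 assms(2) by (intro mult_le_mono fact_blocks_ge_pow2) auto
    finally show ?thesis using split by simp
  qed
qed

section \<open>Permutation groups of small index\<close>

definition three_cycle :: "'a \<Rightarrow> 'a \<Rightarrow> 'a \<Rightarrow> 'a \<Rightarrow> 'a" where
  "three_cycle a b c = (\<lambda>x. if x = a then b else if x = b then c else if x = c then a else x)"

lemma three_cycle_eq_transpose:
  "distinct [a, b, c] \<Longrightarrow> three_cycle a b c = Transposition.transpose a b \<circ> Transposition.transpose b c"
  by (auto simp: fun_eq_iff three_cycle_def Transposition.transpose_def)

lemma three_cycle_permutes:
  "distinct [a, b, c] \<Longrightarrow> {a, b, c} \<subseteq> X \<Longrightarrow> three_cycle a b c permutes X"
  by (simp only: three_cycle_eq_transpose) (auto intro!: permutes_compose permutes_swap_id)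

lemma evenperm_three_cycle: "distinct [a, b, c] \<Longrightarrow> evenperm (three_cycle a b c)"
  by (simp only: three_cycle_eq_transpose)
    (simp add: evenperm_comp permutation_swap_id evenperm_swap)

lemma three_cycle_rotate: "distinct [a, b, c] \<Longrightarrow> three_cycle b c a = three_cycle a b c"
  by (auto simp: fun_eq_iff three_cycle_def)

lemma three_cycle_square:
  "distinct [a, b, c] \<Longrightarrow> three_cycle a b c \<circ> three_cycle a b c = three_cycle a c b"
  by (auto simp: fun_eq_iff three_cycle_def)

lemma three_cycle_conj:
  assumes "p permutes X"
  shows "p \<circ> three_cycle a b c \<circ> inv' p = three_cycle (p a) (p b) (p c)"
proof
  fix x
  obtain y where x: "x = p y" using permutes_surj[OF assms] by (metis surjD)
  show "(p \<circ> three_cycle a b c \<circ> inv' p) x = three_cycle (p a) (p b) (p c) x"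
    using permutes_inj[OF assms] by (auto simp: x three_cycle_def inj_eq permutes_inverses[OF assms])
qed

text \<open>The point \<open>x a\<close> is moved by \<open>x\<close> and differs from
  \<open>a\<close>, so \<open>y\<close> fixes it; likewise \<open>x\<close> fixes
  \<open>y a\<close>. Outside \<open>a\<close>, \<open>x a\<close> and \<open>y a\<close> the two
  permutations do not interact.\<close>

lemma commutator_three_cycle:
  assumes x: "x permutes X" and y: "y permutes X"
    and meet: "\<And>p. x p \<noteq> p \<Longrightarrow> y p \<noteq> p \<Longrightarrow> p = a"
    and xa: "x a \<noteq> a" and ya: "y a \<noteq> a"
  shows "x \<circ> y \<circ> inv' x \<circ> inv' y = three_cycle a (x a) (y a)" "distinct [a, x a, y a]"
proof -
  note ix = permutes_inverses[OF x] and iy = permutes_inverses[OF y]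
  have injx: "x u = x v \<longleftrightarrow> u = v" and injy: "y u = y v \<longleftrightarrow> u = v" for u v
    using permutes_inj[OF x] permutes_inj[OF y] by (auto simp: inj_eq)
  have xx: "y (x a) = x a" using meet[of "x a"] xa injx by metis
  have yy: "x (y a) = y a" using meet[of "y a"] ya injy by metis
  show d: "distinct [a, x a, y a]" using xa ya xx yy injx injy by (simp, metis)
  show "x \<circ> y \<circ> inv' x \<circ> inv' y = three_cycle a (x a) (y a)"
  proof
    fix p
    \<comment> \<open>With \<open>p = y (x s)\<close> both inverses cancel, and the commutator sends
      \<open>p\<close> to \<open>x (y s)\<close>.\<close>
    obtain q where p: "p = y q" using iy by metis
    obtain s where q: "q = x s" using ix by metis
    have l: "(x \<circ> y \<circ> inv' x \<circ> inv' y) p = x (y s)" by (simp add: p q ix iy)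
    show "(x \<circ> y \<circ> inv' x \<circ> inv' y) p = three_cycle a (x a) (y a) p"
    proof (cases "s = a")
      case True
      thus ?thesis unfolding l using d by (auto simp: p q xx yy three_cycle_def)
    next
      case False
      show ?thesis
      proof (cases "x s = s")
        case True
        have "x (y s) = three_cycle a (x a) (y a) (y s)"
          using meet[of "y s"] meet[of s] False True xx yy d injx injy
          by (smt (verit) three_cycle_def)
        thus ?thesis unfolding l by (simp add: p q True)
      next
        case xs: False
        hence ys: "y s = s" using meet[of s] False by blast
        have "x s = three_cycle a (x a) (y a) (y (x s))"
          using meet[of "x s"] False xs ys xx yy d injx injy
          by (smt (verit) three_cycle_def)
        thus ?thesis unfolding l by (simp add: p q ys)
      qed
    qed
  qed
qed

text \<open>A three-cycle that carries \<open>p a\<close> back to \<open>a\<close> turns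
  \<open>p\<close> into an even permutation of \<open>D - {a}\<close>, to which induction
  applies.\<close>

lemma evenperm_in_closure_of_three_cycles:
  assumes "finite D"
    and comp: "\<And>p q. p \<in> H \<Longrightarrow> q \<in> H \<Longrightarrow> p \<circ> q \<in> H" and id: "id \<in> H"
    and cyc: "\<And>a b c. a \<in> D \<Longrightarrow> b \<in> D \<Longrightarrow> c \<in> D \<Longrightarrow> distinct [a, b, c] \<Longrightarrow> three_cycle a b c \<in> H"
    and p: "p permutes D" "evenperm p"
  shows "p \<in> H"
  using assms(1) cyc p
proof (induction D arbitrary: p rule: finite_psubset_induct)
  case (psubset D)
  show ?case
  proof (cases "p = id")
    case True thus ?thesis using id by (simp only:)
  next
    case False
    then obtain a where a: "p a \<noteq> a" by fastforce
    have aD: "a \<in> D" "p a \<in> D"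
      using a psubset.prems(2) by (auto simp: permutes_in_image dest: permutes_not_in)
    \<comment> \<open>Without a third point \<open>p\<close> would be the transposition of
      \<open>a\<close> and \<open>p a\<close>, which is odd.\<close>
    have "\<exists>c\<in>D. c \<noteq> a \<and> c \<noteq> p a"
    proof (rule ccontr)
      assume "\<not> ?thesis"
      hence D: "D = {a, p a}" using aD by auto
      have "p (p a) = a"
      proof -
        have "p (p a) \<in> D" using aD psubset.prems(2) by (simp add: permutes_in_image)
        moreover have "p (p a) \<noteq> p a" using a permutes_inj[OF psubset.prems(2)] by (auto simp: inj_eq)
        ultimately show ?thesis using D by auto
      qed
      hence "p = Transposition.transpose a (p a)"
        using psubset.prems(2) D by (auto simp: fun_eq_iff Transposition.transpose_def dest: permutes_not_in)
      hence "\<not> evenperm p" using a by (metis evenperm_swap)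
      thus False using psubset.prems(3) by simp
    qed
    then obtain c where c: "c \<in> D" "c \<noteq> a" "c \<noteq> p a" by auto
    define t where "t = three_cycle a c (p a)"
    have dt: "distinct [a, c, p a]" "distinct [a, p a, c]" using a c by auto
    have tD: "t permutes D" unfolding t_def using dt aD c by (intro three_cycle_permutes) auto
    define q where "q = t \<circ> p"
    have qa: "q a = a" using dt by (auto simp: q_def t_def three_cycle_def)
    have "q permutes D" unfolding q_def using psubset.prems(2) tD by (rule permutes_compose)
    hence qD: "q permutes (D - {a})"
      using qa by (auto simp: permutes_def)
    have ev: "evenperm q" unfolding q_def
      using psubset.prems(2,3) tD evenperm_three_cycle[OF dt(1)] psubset.hyps
      by (subst evenperm_comp) (auto simp: t_def permutation_permutes)
    have "q \<in> H"
      by (rule psubset.IH[OF _ _ qD ev]) (use aD psubset.prems(1) in auto)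
    moreover have "three_cycle a (p a) c \<in> H" using psubset.prems(1) aD c dt by blast
    moreover have "three_cycle a (p a) c \<circ> q = p"
      using dt by (auto simp: q_def t_def three_cycle_def fun_eq_iff)
    ultimately show ?thesis using comp by metis
  qed
qed

section \<open>Permutation groups on a finite set and bounds for their order\<close>

locale perm_group =
  fixes X :: "'a set" and H :: "('a \<Rightarrow> 'a) set"
  assumes finite_X: "finite X"
    and permutes: "p \<in> H \<Longrightarrow> p permutes X"
    and id_mem: "id \<in> H"
    and comp_mem: "p \<in> H \<Longrightarrow> q \<in> H \<Longrightarrow> p \<circ> q \<in> H"
    and inv_mem: "p \<in> H \<Longrightarrow> inv' p \<in> H"
begin

lemma finite_H: "finite H"
  using permutes finite_permutations[OF finite_X] by (metis (no_types, lifting) finite_subset mem_Collect_eq subsetI)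

lemma inj: "p \<in> H \<Longrightarrow> p x = p y \<longleftrightarrow> x = y"
  using permutes permutes_inj by (metis injD)

lemma inv_apply: "p \<in> H \<Longrightarrow> inv' p (p x) = x" "p \<in> H \<Longrightarrow> p (inv' p x) = x"
  using permutes permutes_inverses by metis+

definition fixer :: "'a set \<Rightarrow> ('a \<Rightarrow> 'a) set" where
  "fixer T = {p \<in> H. \<forall>x\<in>T. p x = x}"

text \<open>This is why the ground set is a parameter of the locale: every order estimate can be
  applied again to a fixer, on fewer points.\<close>

lemma fixer_perm_group: "perm_group (X - T) (fixer T)"
proof
  show "finite (X - T)" using finite_X by simp
  show "p permutes X - T" if "p \<in> fixer T" for p
    using that permutes[of p] by (auto simp: fixer_def permutes_def)
  show "id \<in> fixer T" by (simp add: fixer_def id_mem)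
  show "p \<circ> q \<in> fixer T" if "p \<in> fixer T" "q \<in> fixer T" for p q
    using that comp_mem by (auto simp: fixer_def)
  show "inv' p \<in> fixer T" if "p \<in> fixer T" for p
    using that inv_mem inv_apply by (auto simp: fixer_def) metis
qed

text \<open>The elements with a given restriction to \<open>T\<close> form a coset of the pointwise
  fixer.\<close>

lemma card_le_restrictions_fixer:
  "card H \<le> card ((\<lambda>p. restrict p T) ` H) * card (fixer T)"
proof -
  have "card H = card (\<Union>f\<in>(\<lambda>p. restrict p T) ` H. {p \<in> H. restrict p T = f})"
    by (rule arg_cong[of _ _ card]) auto
  also have "\<dots> \<le> (\<Sum>f\<in>(\<lambda>p. restrict p T) ` H. card {p \<in> H. restrict p T = f})"
    by (rule card_UN_le) (simp add: finite_H)
  also have "\<dots> \<le> (\<Sum>f\<in>(\<lambda>p. restrict p T) ` H. card (fixer T))"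
  proof (rule sum_mono)
    fix f assume "f \<in> (\<lambda>p. restrict p T) ` H"
    then obtain q where q: "q \<in> H" "f = restrict q T" by auto
    have "(\<lambda>p. inv' q \<circ> p) ` {p \<in> H. restrict p T = f} \<subseteq> fixer T"
    proof safe
      fix p assume p: "p \<in> H" "f = restrict p T"
      hence "p x = q x" if "x \<in> T" for x using that q by (metis restrict_apply')
      thus "inv' q \<circ> p \<in> fixer T"
        using p q inv_apply comp_mem inv_mem by (auto simp: fixer_def)
    qed
    moreover have "inj_on (\<lambda>p. inv' q \<circ> p) {p \<in> H. restrict p T = f}"
    proof (rule inj_onI)
      fix p p' assume "inv' q \<circ> p = inv' q \<circ> p'"
      hence "q \<circ> (inv' q \<circ> p) = q \<circ> (inv' q \<circ> p')" by simp
      thus "p = p'" using inv_apply(2)[OF q(1)] by (simp add: fun_eq_iff)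
    qed
    moreover have "finite (fixer T)" using finite_H by (simp add: fixer_def)
    ultimately show "card {p \<in> H. restrict p T = f} \<le> card (fixer T)"
      by (meson card_inj_on_le)
  qed
  finally show ?thesis by simp
qed

definition invariant :: "'a set \<Rightarrow> bool" where
  "invariant Y \<longleftrightarrow> Y \<subseteq> X \<and> (\<forall>p\<in>H. \<forall>x\<in>Y. p x \<in> Y)"

lemma invariant_Diff:
  assumes "invariant Z" "invariant Y" shows "invariant (Z - Y)"
proof -
  have "p x \<notin> Y" if "p \<in> H" "x \<notin> Y" for p x
    using assms(2) inv_mem[OF that(1)] inv_apply(1)[OF that(1), of x] that(2)
    unfolding invariant_def by metis
  thus ?thesis using assms by (auto simp: invariant_def)
qed

lemma invariant_X: "invariant X"
  using permutes by (auto simp: invariant_def permutes_in_image)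

lemma card_restrictions_invariant:
  assumes "invariant Y"
  shows "card ((\<lambda>p. restrict p Y) ` H) \<le> fact (card Y)"
proof -
  have fY: "finite Y" using assms finite_X by (auto simp: invariant_def intro: finite_subset)
  have "(\<lambda>p. restrict p Y) ` H \<subseteq> (\<lambda>p. restrict p Y) ` {p. p permutes Y}"
  proof safe
    fix p assume p: "p \<in> H"
    define q where "q = (\<lambda>x. if x \<in> Y then p x else x)"
    have "inj_on q Y" using inj[OF p] by (auto simp: inj_on_def q_def)
    moreover have "q ` Y \<subseteq> Y" using assms p by (auto simp: q_def invariant_def)
    ultimately have "bij_betw q Y Y" using fY by (simp add: bij_betw_def endo_inj_surj)
    hence "q permutes Y" by (rule bij_imp_permutes) (simp add: q_def)
    moreover have "restrict p Y = restrict q Y" by (auto simp: q_def restrict_def)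
    ultimately show "restrict p Y \<in> (\<lambda>p. restrict p Y) ` {p. p permutes Y}" by auto
  qed
  hence "card ((\<lambda>p. restrict p Y) ` H) \<le> card ((\<lambda>p. restrict p Y) ` {p. p permutes Y})"
    using finite_permutations[OF fY] by (intro card_mono) auto
  also have "\<dots> \<le> card {p. p permutes Y}" using finite_permutations[OF fY] by (rule card_image_le)
  also have "\<dots> = fact (card Y)" using fY by (simp add: card_permutations)
  finally show ?thesis .
qed

lemma card_le_fact_fixer:
  assumes "invariant Y"
  shows "card H \<le> fact (card Y) * card (fixer Y)"
  using card_le_restrictions_fixer[of Y] card_restrictions_invariant[OF assms]
  by (meson le_trans mult_le_mono1)

lemma card_le_fact: "card H \<le> fact (card X)"
proof -
  have "card H \<le> card {p. p permutes X}"
    using permutes finite_permutations[OF finite_X] by (intro card_mono) auto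
  thus ?thesis using finite_X by (simp add: card_permutations)
qed

lemma card_le_fact_fact:
  assumes "invariant Y"
  shows "card H \<le> fact (card Y) * fact (card X - card Y)"
proof -
  interpret F: perm_group "X - Y" "fixer Y" by (rule fixer_perm_group)
  have "card (X - Y) = card X - card Y"
    using assms finite_X by (intro card_Diff_subset) (auto simp: invariant_def intro: finite_subset)
  thus ?thesis using card_le_fact_fixer[OF assms] F.card_le_fact by (metis le_trans mult_le_mono2)
qed

text \<open>Bochert's argument: a base of minimal size has at most half of the points, since otherwise
  there are two elements whose supports meet in a single point.\<close>

lemma card_le_without_three_cycles:
  assumes no: "\<And>a b c. distinct [a, b, c] \<Longrightarrow> three_cycle a b c \<notin> H"
  shows "card H * fact (card X - card X div 2) \<le> fact (card X)"
proof -
  have ex: "\<exists>B. B \<subseteq> X \<and> fixer B = {id}"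
  proof (intro exI conjI)
    show "fixer X = {id}"
      using permutes id_mem by (auto simp: fixer_def fun_eq_iff) (metis permutes_not_in)
  qed simp
  define B where "B = arg_min card (\<lambda>B. B \<subseteq> X \<and> fixer B = {id})"
  have B: "B \<subseteq> X" "fixer B = {id}"
    using arg_min_natI[of "\<lambda>B. B \<subseteq> X \<and> fixer B = {id}", OF ] ex unfolding B_def by metis+
  have Bmin: "card B \<le> card C" if "C \<subseteq> X" "fixer C = {id}" for C
    using arg_min_nat_le[of "\<lambda>B. B \<subseteq> X \<and> fixer B = {id}" C card] that unfolding B_def by simp
  have fB: "finite B" using B(1) finite_X by (rule finite_subset)
  have nontriv: "\<exists>p\<in>H. p \<noteq> id \<and> (\<forall>x\<in>C. p x = x)" if "C \<subseteq> X" "card C < card B" for C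
  proof -
    have "fixer C \<noteq> {id}" using Bmin[of C] that by linarith
    thus ?thesis using id_mem by (auto simp: fixer_def)
  qed
  have half: "card B \<le> card X div 2"
  proof (rule ccontr)
    assume "\<not> ?thesis"
    hence "card (X - B) < card B" using B(1) fB by (simp add: card_Diff_subset)
    then obtain x where x: "x \<in> H" "x \<noteq> id" "\<forall>p\<in>X - B. x p = p"
      using nontriv[of "X - B"] by blast
    then obtain a where a: "x a \<noteq> a" by fastforce
    have aB: "a \<in> B" using a x permutes[OF x(1)] by (metis DiffI permutes_not_in)
    have "card (B - {a}) < card B" using aB fB by (meson card_Diff1_less)
    then obtain y where y: "y \<in> H" "y \<noteq> id" "\<forall>p\<in>B - {a}. y p = p"
      using nontriv[of "B - {a}"] B(1) by blast
    have ya: "y a \<noteq> a"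
    proof
      assume "y a = a"
      hence "y \<in> fixer B" using y by (auto simp: fixer_def)
      thus False using B(2) y(2) by simp
    qed
    have meet: "p = a" if "x p \<noteq> p" "y p \<noteq> p" for p
      using that x(3) y(3) permutes[OF x(1)] by (metis DiffI permutes_not_in singletonD)
    note c = commutator_three_cycle[OF permutes[OF x(1)] permutes[OF y(1)] meet a ya]
    have "x \<circ> y \<circ> inv' x \<circ> inv' y \<in> H" using x(1) y(1) by (intro comp_mem inv_mem)
    thus False using no[OF c(2)] c(1) by simp
  qed
  obtain bs where bs: "set bs = B" "distinct bs" using finite_distinct_list[OF fB] by auto
  have len: "length bs = card B" using bs distinct_card by metis
  \<comment> \<open>An element is determined by its values on the base, so \<open>H\<close> embeds
    into the repetition-free lists of length \<open>card B\<close> over \<open>X\<close>.\<close>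
  have "inj_on (\<lambda>p. map p bs) H"
  proof (rule inj_onI)
    fix p q assume pq: "p \<in> H" "q \<in> H" "map p bs = map q bs"
    hence "\<forall>x\<in>B. p x = q x" using bs by auto
    hence "inv' q \<circ> p \<in> fixer B"
      using pq inv_apply comp_mem inv_mem by (auto simp: fixer_def)
    hence "inv' q \<circ> p = id" using B(2) by auto
    hence "inv' q (p x) = x" for x by (metis comp_apply id_apply)
    hence "p x = q x" for x by (metis pq(2) inv_apply(2))
    thus "p = q" by blast
  qed
  moreover have "(\<lambda>p. map p bs) ` H \<subseteq> {xs. length xs = card B \<and> distinct xs \<and> set xs \<subseteq> X}"
  proof safe
    fix p assume p: "p \<in> H"
    show "length (map p bs) = card B" using len by simp
    show "distinct (map p bs)" using bs inj[OF p] by (auto simp: distinct_map inj_on_def)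
    show "x \<in> X" if "x \<in> set (map p bs)" for x
      using that bs B(1) permutes_in_image[OF permutes[OF p]] by auto
  qed
  moreover have "finite {xs. length xs = card B \<and> distinct xs \<and> set xs \<subseteq> X}"
    by (rule finite_subset[OF _ finite_lists_length_eq[OF finite_X, of "card B"]]) auto
  moreover have bX: "card B \<le> card X" using B(1) finite_X by (rule card_mono[rotated])
  ultimately have 1: "card H \<le> \<Prod>{card X - card B + 1..card X}"
    using card_inj_on_le[of "\<lambda>p. map p bs" H "{xs. length xs = card B \<and> distinct xs \<and> set xs \<subseteq> X}"]
      card_lists_distinct_length_eq[OF finite_X bX] by simp
  have "card H * fact (card X - card X div 2) \<le> \<Prod>{card X - card B + 1..card X} * fact (card X - card B)"
    using 1 half by (intro mult_le_mono fact_mono) auto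
  also have "\<dots> = fact (card X)"
    using fact_eq_fact_times[of "card X - card B" "card X"] by (simp add: ac_simps)
  finally show ?thesis .
qed

text \<open>An equivalence relation preserved by \<open>H\<close>, so its classes are blocks. Only
  some third point \<open>c\<close> is demanded; \<open>linked_three_cycle\<close> shows that any
  third point of the class then works, so \<open>H\<close> contains every three-cycle inside a
  class.\<close>

definition linked :: "'a \<Rightarrow> 'a \<Rightarrow> bool" where
  "linked a b \<longleftrightarrow> a = b \<or> (\<exists>c. distinct [a, b, c] \<and> three_cycle a b c \<in> H)"

lemma three_cycle_perms:
  assumes "three_cycle a b c \<in> H" "distinct [a, b, c]"
  shows "three_cycle b c a \<in> H" "three_cycle c a b \<in> H"
    "three_cycle a c b \<in> H" "three_cycle c b a \<in> H" "three_cycle b a c \<in> H"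
proof -
  have d: "distinct [b, c, a]" "distinct [c, a, b]" "distinct [a, c, b]" "distinct [c, b, a]"
    using assms(2) by auto
  show 1: "three_cycle b c a \<in> H" using assms three_cycle_rotate[OF assms(2)] by simp
  show "three_cycle c a b \<in> H" using 1 three_cycle_rotate[OF d(1)] by simp
  show 2: "three_cycle a c b \<in> H"
    using comp_mem[OF assms(1,1)] three_cycle_square[OF assms(2)] by simp
  show 3: "three_cycle c b a \<in> H" using 2 three_cycle_rotate[OF d(3)] by simp
  show "three_cycle b a c \<in> H" using 3 three_cycle_rotate[OF d(4)] by simp
qed

lemma conj_mem:
  assumes "p \<in> H" "three_cycle a b c \<in> H"
  shows "three_cycle (p a) (p b) (p c) \<in> H"
  using comp_mem[OF comp_mem[OF assms] inv_mem[OF assms(1)]] three_cycle_conj[OF permutes[OF assms(1)]]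
  by metis

lemma linked_refl: "linked a a" by (simp add: linked_def)

lemma linked_sym: "linked a b \<Longrightarrow> linked b a"
proof -
  assume "linked a b"
  thus "linked b a"
  proof (cases "a = b")
    case False
    then obtain c where "distinct [a, b, c]" "three_cycle a b c \<in> H"
      using \<open>linked a b\<close> by (auto simp: linked_def)
    thus ?thesis using three_cycle_perms(5)[of a b c] by (auto simp: linked_def)
  qed (simp add: linked_def)
qed

lemma linked_image: "p \<in> H \<Longrightarrow> linked a b \<Longrightarrow> linked (p a) (p b)"
  using conj_mem inj unfolding linked_def by (metis distinct_length_2_or_more distinct_singleton)

text \<open>If the three-cycle through \<open>y\<close> and \<open>z\<close> avoids
  \<open>x\<close>, it fixes \<open>x\<close> and sends \<open>y\<close> to \<open>z\<close>, hence
  carries the link between \<open>x\<close> and \<open>y\<close> to one between \<open>x\<close> and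
  \<open>z\<close>. Otherwise its third point is \<open>x\<close>, and it links \<open>x\<close> and
  \<open>z\<close> itself.\<close>

lemma linked_trans:
  assumes "linked x y" "linked y z" shows "linked x z"
proof (cases "x = y \<or> y = z \<or> x = z")
  case True
  thus ?thesis using assms by (auto simp: linked_refl)
next
  case False
  then obtain a b where a: "distinct [x, y, a]" "three_cycle x y a \<in> H"
    and b: "distinct [y, z, b]" "three_cycle y z b \<in> H"
    using assms by (auto simp: linked_def)
  show ?thesis
  proof (cases "b = x")
    case True
    thus ?thesis using three_cycle_perms(4)[OF b(2,1)] False b unfolding linked_def
      by (auto intro!: exI[of _ y])
  next
    case bx: False
    define g where "g = three_cycle y z b"
    have g: "g x = x" "g y = z" using bx False by (auto simp: g_def three_cycle_def)
    have "linked (g x) (g y)"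
      by (rule linked_image) (use b assms(1) in \<open>auto simp: g_def\<close>)
    thus ?thesis by (simp add: g)
  qed
qed

text \<open>The cycle through \<open>x\<close>, \<open>y\<close>, \<open>a\<close> is conjugated by
  one through \<open>a\<close>, \<open>z\<close>, \<open>c\<close>. If \<open>c\<close> is neither
  \<open>x\<close> nor \<open>y\<close>, this just replaces \<open>a\<close> by \<open>z\<close>. If
  \<open>c\<close> is one of them, the inverse of the second cycle is used and the result is a
  three-cycle on \<open>x\<close>, \<open>y\<close>, \<open>z\<close> in the other
  orientation.\<close>

lemma linked_three_cycle:
  assumes "linked x y" "linked y z" "distinct [x, y, z]"
  shows "three_cycle x y z \<in> H"
proof -
  obtain a where a: "distinct [x, y, a]" "three_cycle x y a \<in> H"
    using assms by (auto simp: linked_def)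
  show ?thesis
  proof (cases "a = z")
    case True thus ?thesis using a by simp
  next
    case False
    have "linked x a" using three_cycle_perms(3)[OF a(2,1)] a(1) by (auto simp: linked_def)
    hence "linked a z" using assms linked_sym linked_trans by blast
    then obtain c where c: "distinct [a, z, c]" "three_cycle a z c \<in> H"
      using False by (auto simp: linked_def)
    note c' = three_cycle_perms[OF c(2,1)]
    consider "c = x" | "c = y" | "c \<noteq> x" "c \<noteq> y" by blast
    thus ?thesis
    proof cases
      case 1
      have "three_cycle a x z \<in> H" using c'(3) 1 by simp
      from conj_mem[OF this a(2)] have "three_cycle z y x \<in> H"
        using assms a c 1 by (simp add: three_cycle_def split: if_splits)
      thus ?thesis using three_cycle_perms(4)[of z y x] assms by auto
    next
      case 2
      have "three_cycle a y z \<in> H" using c'(3) 2 by simp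
      from conj_mem[OF this a(2)] have "three_cycle x z y \<in> H"
        using assms a c 2 by (simp add: three_cycle_def split: if_splits)
      thus ?thesis using three_cycle_perms(3)[of x z y] assms by auto
    next
      case 3
      from conj_mem[OF c(2) a(2)] show ?thesis
        using assms a c 3 by (simp add: three_cycle_def split: if_splits)
    qed
  qed
qed

lemma linked_imp_same_orbit: "linked a b \<Longrightarrow> \<exists>p\<in>H. p a = b"
  unfolding linked_def using id_mem by (metis id_apply three_cycle_def)

text \<open>A smallest invariant set with more than \<open>k\<close> points is a single orbit:
  otherwise it splits into two invariant parts of at most \<open>k\<close> points each, although
  \<open>gap\<close> gives it at least \<open>card X - k > 2 * k\<close>.\<close>

lemma exists_large_orbit:
  assumes gap: "\<And>Y. invariant Y \<Longrightarrow> card Y \<le> k \<or> card X - k \<le> card Y"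
    and k: "3 * k < card X"
  shows "\<exists>Z. invariant Z \<and> card X - k \<le> card Z \<and> (\<forall>x\<in>Z. \<forall>y\<in>Z. \<exists>p\<in>H. p x = y)"
proof -
  define Q where "Q = (\<lambda>Z. invariant Z \<and> k < card Z)"
  define Z where "Z = arg_min card Q"
  have "Q X" using k invariant_X by (auto simp: Q_def)
  hence Z: "Q Z" unfolding Z_def by (rule arg_min_natI)
  have Zmin: "card Z \<le> card Y" if "Q Y" for Y
    unfolding Z_def using that by (rule arg_min_nat_le)
  have fZ: "finite Z" using Z finite_X by (auto simp: Q_def invariant_def intro: finite_subset)
  have big: "card X - k \<le> card Z" using gap[of Z] Z by (auto simp: Q_def)
  have "\<exists>p\<in>H. p x = y" if xy: "x \<in> Z" "y \<in> Z" for x y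
  proof (rule ccontr)
    assume neg: "\<not> ?thesis"
    define W where "W = {p x | p. p \<in> H}"
    have W: "invariant W" unfolding invariant_def
    proof (intro conjI ballI)
      show "W \<subseteq> X" using xy(1) Z permutes by (auto simp: W_def Q_def invariant_def permutes_in_image)
      fix p u assume p: "p \<in> H" and "u \<in> W"
      then obtain q where q: "q \<in> H" "u = q x" by (auto simp: W_def)
      have "p u = (p \<circ> q) x" by (simp add: q)
      thus "p u \<in> W" unfolding W_def using comp_mem[OF p q(1)] by blast
    qed
    have WZ: "W \<subseteq> Z" using xy(1) Z by (auto simp: W_def Q_def invariant_def)
    have xW: "x \<in> W" unfolding W_def using id_mem by (intro CollectI exI[of _ id]) simp
    have yW: "y \<notin> W" using neg by (auto simp: W_def)
    have "W \<subset> Z" using WZ yW xy by auto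
    hence "card W < card Z" using fZ by (rule psubset_card_mono[rotated])
    hence 1: "card W \<le> k" using Zmin[of W] W unfolding Q_def by (meson leD not_le_imp_less)
    have "Z - W \<subset> Z" using xW WZ by auto
    hence "card (Z - W) < card Z" using fZ by (rule psubset_card_mono[rotated])
    hence 2: "card (Z - W) \<le> k"
      using Zmin[of "Z - W"] invariant_Diff[OF _ W, of Z] Z unfolding Q_def by (meson leD not_le_imp_less)
    have "card Z = card W + card (Z - W)"
      using WZ fZ by (metis card_Diff_subset card_mono finite_subset le_add_diff_inverse)
    thus False using 1 2 big k by linarith
  qed
  thus ?thesis using Z big by (auto simp: Q_def)
qed

end

text \<open>Restricted to one of \<open>Suc r\<close> blocks, an element is given by the target
  block and a bijection onto it, which leaves \<open>Suc r * fact d\<close> choices; the pointwise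
  fixer of that block permutes the other blocks. The induction thus changes both the group and its
  ground set.\<close>

lemma card_le_block_preserving:
  assumes "perm_group X H" "finite \<B>" "card \<B> = r"
    and "\<And>b. b \<in> \<B> \<Longrightarrow> b \<subseteq> X \<and> card b = d" "pairwise disjnt \<B>"
    and "\<And>p b. p \<in> H \<Longrightarrow> b \<in> \<B> \<Longrightarrow> p ` b \<in> \<B>"
  shows "card H \<le> fact r * fact d ^ r * fact (card X - r * d)"
  using assms
proof (induction r arbitrary: X H \<B>)
  case 0
  thus ?case using perm_group.card_le_fact by auto
next
  case (Suc r)
  interpret perm_group X H by fact
  obtain b where b: "b \<in> \<B>" using Suc.prems(3) by fastforce
  have bX: "b \<subseteq> X" "card b = d" "finite b"
    using Suc.prems(4)[OF b] finite_X by (auto intro: finite_subset)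
  obtain bs where bs: "set bs = b" "distinct bs" using finite_distinct_list[OF bX(3)] by auto
  have len: "length bs = d" using bs bX distinct_card by metis
  have "card ((\<lambda>p. restrict p b) ` H) \<le> Suc r * fact d"
  proof -
    let ?L = "\<lambda>c. {xs. length xs = d \<and> distinct xs \<and> set xs \<subseteq> c}"
    have fin: "finite (?L c)" if "c \<in> \<B>" for c
      by (rule finite_subset[OF _ finite_lists_length_eq[of c d]])
        (use Suc.prems(4)[OF that] finite_X in \<open>auto intro: finite_subset\<close>)
    have "inj_on (\<lambda>f. map f bs) ((\<lambda>p. restrict p b) ` H)"
      by (rule inj_onI) (auto simp: restrict_def fun_eq_iff simp flip: bs(1))
    moreover have "(\<lambda>f. map f bs) ` (\<lambda>p. restrict p b) ` H \<subseteq> (\<Union>c\<in>\<B>. ?L c)"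
    proof safe
      fix p assume p: "p \<in> H"
      have e: "map (restrict p b) bs = map p bs" using bs by auto
      have "distinct (map p bs)" using bs inj[OF p] by (auto simp: distinct_map inj_on_def)
      thus "map (restrict p b) bs \<in> (\<Union>c\<in>\<B>. ?L c)"
        using Suc.prems(6)[OF p b] len bs unfolding e by auto
    qed
    moreover have "finite (\<Union>c\<in>\<B>. ?L c)" using fin Suc.prems(2) by blast
    ultimately have "card ((\<lambda>p. restrict p b) ` H) \<le> card (\<Union>c\<in>\<B>. ?L c)"
      by (rule card_inj_on_le)
    also have "\<dots> \<le> (\<Sum>c\<in>\<B>. card (?L c))" using Suc.prems(2) by (rule card_UN_le)
    also have "\<dots> = (\<Sum>c\<in>\<B>. fact d)"
    proof (rule sum.cong)
      fix c assume "c \<in> \<B>"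
      hence "finite c" "card c = d" using Suc.prems(4) finite_X by (auto intro: finite_subset)
      thus "card (?L c) = fact d" using card_lists_distinct_length_eq[of c d] by (simp add: fact_prod)
    qed simp
    finally show ?thesis using Suc.prems(3) by simp
  qed
  moreover have "card (fixer b) \<le> fact r * fact d ^ r * fact (card (X - b) - r * d)"
  proof (rule Suc.IH)
    show "perm_group (X - b) (fixer b)" by (rule fixer_perm_group)
    show "finite (\<B> - {b})" "card (\<B> - {b}) = r" "pairwise disjnt (\<B> - {b})"
      using Suc.prems(2,3,5) b by (auto simp: pairwise_def)
    show "c \<subseteq> X - b \<and> card c = d" if "c \<in> \<B> - {b}" for c
      using that Suc.prems(4)[of c] pairwiseD[OF Suc.prems(5), of b c] b by (auto simp: disjnt_def)
    show "p ` c \<in> \<B> - {b}" if "p \<in> fixer b" "c \<in> \<B> - {b}" for p c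
    proof -
      have p: "p \<in> H" "p ` b = b" using that(1) by (auto simp: fixer_def)
      have "p ` c \<noteq> p ` b"
        using that(2) permutes_inj[OF permutes[OF p(1)]] by (metis Diff_iff inj_image_eq_iff singletonI)
      thus ?thesis using Suc.prems(6)[OF p(1), of c] that(2) p(2) by auto
    qed
  qed
  moreover have "card (X - b) - r * d = card X - Suc r * d"
    using bX finite_X by (simp add: card_Diff_subset)
  ultimately have "card H \<le> (Suc r * fact d) * (fact r * fact d ^ r * fact (card X - Suc r * d))"
    by (intro order_trans[OF card_le_restrictions_fixer[of b]] mult_le_mono) simp_all
  thus ?case by (simp add: algebra_simps)
qed

context perm_group
begin

text \<open>The hypothesis \<open>index\<close> says that \<open>card H\<close> exceeds the order of
  the alternating group divided by \<open>card X choose k\<close>. Orbits, blocks and Bochert's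
  bound successively exclude everything except a group containing all even permutations of one large
  orbit, and \<open>T\<close> is the complement of that orbit.\<close>

theorem contains_alternating_of_small_index:
  assumes n: "card X \<ge> 10" and k: "4 * k + 2 \<le> card X"
    and index: "fact (card X) < 2 * card H * (card X choose k)"
  shows "\<exists>T\<subseteq>X. card T \<le> k \<and> (\<forall>p. p permutes X - T \<longrightarrow> evenperm p \<longrightarrow> p \<in> H)"
proof -
  define n where "n = card X"
  have contra: False if "2 * (n choose k) * card H \<le> fact n"
    using that index by (simp add: n_def ac_simps)
  have gap: "card Y \<le> k \<or> card X - k \<le> card Y" if Y: "invariant Y" for Y
  proof (rule ccontr)
    assume "\<not> ?thesis"
    hence Yc: "Suc k \<le> card Y" "Suc k \<le> n - card Y" "card Y \<le> n" by (auto simp: n_def)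
    \<comment> \<open>The doubling absorbs the index \<open>2\<close> of the alternating group in
      the symmetric group.\<close>
    have "2 * (n choose k) \<le> n choose Suc k" using k by (intro binomial_step_double) (simp add: n_def)
    also have "\<dots> \<le> n choose card Y"
    proof (cases "2 * card Y \<le> n")
      case True thus ?thesis using Yc by (intro binomial_mono)
    next
      case False
      hence "n choose Suc k \<le> n choose (n - card Y)" using Yc by (intro binomial_mono) auto
      thus ?thesis using binomial_symmetric[OF Yc(3)] by simp
    qed
    finally have "2 * (n choose k) * card H \<le> (n choose card Y) * (fact (card Y) * fact (n - card Y))"
      using card_le_fact_fact[OF Y] unfolding n_def by (intro mult_le_mono)
    thus False using contra fact_eq_binomial_mult[OF Yc(3)] by simp
  qed
  obtain Z where Z: "invariant Z" "card X - k \<le> card Z"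
    and trans: "\<And>x y. x \<in> Z \<Longrightarrow> y \<in> Z \<Longrightarrow> \<exists>p\<in>H. p x = y"
    using exists_large_orbit[of k] gap k by auto
  have ZX: "Z \<subseteq> X" using Z(1) by (simp add: invariant_def)
  have fZ: "finite Z" using ZX finite_X by (rule finite_subset)
  define N where "N = card Z"
  define T where "T = X - Z"
  define t where "t = card T"
  \<comment> \<open>The \<open>t\<close> points outside the orbit account for the factor
    \<open>n choose t\<close> of the index. The action on the orbit then only has to be beaten with
    \<open>N choose s\<close>, since
    \<open>n choose k \<le> (n choose t) * (N choose s)\<close>.\<close>
  define s where "s = k - t"
  have Nn: "N \<le> n" unfolding N_def n_def using ZX finite_X by (rule card_mono[rotated])
  have t: "t = n - N" unfolding t_def T_def n_def N_def using ZX fZ by (simp add: card_Diff_subset)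
  have tk: "t \<le> k" "t \<le> n" "n - t = N" using Z(2) Nn by (auto simp: t n_def N_def)
  have N8: "N \<ge> 8" using Z(2) k n by (auto simp: N_def)
  have s4: "4 * s + 2 \<le> N" using tk k t Nn by (auto simp: s_def n_def)
  have invT: "invariant T" unfolding T_def by (rule invariant_Diff[OF invariant_X Z(1)])
  have choose: "n choose k \<le> (n choose t) * (N choose s)"
  proof -
    have "(n choose k) * (k choose t) = (n choose t) * (N choose s)"
      using choose_mult[of t k n] tk k by (simp add: s_def n_def)
    moreover have "1 \<le> k choose t" using tk by (simp add: Suc_leI)
    ultimately show ?thesis by (metis mult.right_neutral mult_le_mono2)
  qed
  have bound: False if R: "2 * (N choose s) * R \<le> fact N" "card H \<le> fact t * R" for R
  proof -
    have "2 * (n choose k) * card H \<le> 2 * ((n choose t) * (N choose s)) * (fact t * R)"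
      using choose R(2) by (intro mult_le_mono) auto
    also have "\<dots> = (n choose t) * (fact t * (2 * (N choose s) * R))" by (simp only: ac_simps)
    also have "\<dots> \<le> (n choose t) * (fact t * fact N)" using R(1) by (intro mult_le_mono) auto
    also have "\<dots> = fact n" using fact_eq_binomial_mult[OF tk(2)] tk(3) by simp
    finally show False by (rule contra)
  qed
  define cls where "cls = (\<lambda>x. {y. linked x y})"
  have clsZ: "cls x \<subseteq> Z" if "x \<in> Z" for x
    using linked_imp_same_orbit that Z(1) by (fastforce simp: cls_def invariant_def)
  have cls_eq: "cls x = cls y" if "linked x y" for x y
    unfolding cls_def using that linked_sym linked_trans by blast
  have cls_image: "p ` cls x = cls (p x)" if p: "p \<in> H" for p x
  proof safe
    fix y assume "y \<in> cls x" thus "p y \<in> cls (p x)" using linked_image[OF p] by (simp add: cls_def)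
  next
    fix y assume "y \<in> cls (p x)"
    hence "linked (inv' p (p x)) (inv' p y)" using linked_image[OF inv_mem[OF p]] by (simp add: cls_def)
    hence "inv' p y \<in> cls x" using inv_apply[OF p] by (simp add: cls_def)
    thus "y \<in> p ` cls x" using inv_apply(2)[OF p] by (metis imageI)
  qed
  obtain x0 where x0: "x0 \<in> Z" using N8 fZ by (fastforce simp: N_def)
  define d where "d = card (cls x0)"
  have card_cls: "card (cls x) = d" if xZ: "x \<in> Z" for x
  proof -
    obtain p where p: "p \<in> H" "p x0 = x" using trans[OF x0 xZ] by blast
    have "card (p ` cls x0) = card (cls x0)"
      by (rule card_image) (use inj[OF p(1)] in \<open>auto simp: inj_on_def\<close>)
    thus ?thesis using cls_image[OF p(1), of x0] p(2) by (simp add: d_def)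
  qed
  define \<B> where "\<B> = cls ` Z"
  have UB: "\<Union>\<B> = Z" using clsZ linked_refl by (auto simp: \<B>_def cls_def)
  have fB: "finite \<B>" using fZ by (simp add: \<B>_def)
  have disj: "pairwise disjnt \<B>"
  proof (rule pairwiseI)
    fix b c assume "b \<in> \<B>" "c \<in> \<B>" "b \<noteq> c"
    then obtain x y where "b = cls x" "c = cls y" "cls x \<noteq> cls y" by (auto simp: \<B>_def)
    thus "disjnt b c"
      using cls_eq linked_sym unfolding disjnt_def cls_def by blast
  qed
  define r where "r = card \<B>"
  have Nrd: "N = r * d"
  proof -
    have "card (\<Union>\<B>) = sum card \<B>"
      using disj UB fZ by (intro card_Union_disjoint) (auto simp: pairwise_def intro: finite_subset)
    also have "\<dots> = (\<Sum>b\<in>\<B>. d)" by (rule sum.cong) (auto simp: \<B>_def card_cls)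
    finally show ?thesis by (simp add: UB N_def r_def)
  qed
  show ?thesis
  proof (cases "r = 1")
    case True
    hence all: "cls x = Z" if "x \<in> Z" for x
      using card_cls[OF that] Nrd clsZ[OF that] fZ by (simp add: N_def card_subset_eq)
    have "p \<in> H" if p: "p permutes X - T" "evenperm p" for p
    proof (rule evenperm_in_closure_of_three_cycles[OF fZ comp_mem id_mem])
      show "p permutes Z" using p(1) ZX by (simp add: T_def double_diff)
      show "three_cycle a b c \<in> H" if "a \<in> Z" "b \<in> Z" "c \<in> Z" "distinct [a, b, c]" for a b c
        using that all by (intro linked_three_cycle) (auto simp: cls_def)
    qed (use p in auto)
    moreover have "T \<subseteq> X" by (auto simp: T_def)
    ultimately show ?thesis using tk(1) unfolding t_def by blast
  next
    case r1: False
    have "r \<noteq> 0" using Nrd N8 by (cases r) simp_all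
    hence r2: "r \<ge> 2" using r1 by simp
    show ?thesis
    proof (cases "d = 1")
      case True
      interpret F: perm_group "X - T" "fixer T" by (rule fixer_perm_group)
      have XT: "X - T = Z" using ZX by (auto simp: T_def)
      \<comment> \<open>A three-cycle fixing \<open>T\<close> moves points of \<open>Z\<close> only
        and would put two of them into one class.\<close>
      have "three_cycle a b c \<notin> fixer T" if abc: "distinct [a, b, c]" for a b c
      proof
        assume m: "three_cycle a b c \<in> fixer T"
        hence "linked a b" using abc by (auto simp: linked_def fixer_def)
        moreover have "three_cycle a b c a \<noteq> a" using abc by (auto simp: three_cycle_def)
        hence "a \<in> Z" using permutes_not_in[OF F.permutes[OF m]] XT by auto
        moreover have "a \<in> cls a" "b \<in> cls a" using calculation(1) linked_refl by (auto simp: cls_def)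
        ultimately have "card {a, b} \<le> d"
          using card_cls[of a] clsZ[of a] fZ card_mono[of "cls a" "{a, b}"] by (auto intro: finite_subset)
        thus False using True abc by auto
      qed
      hence "card (fixer T) * fact (N - N div 2) \<le> fact N"
        using F.card_le_without_three_cycles unfolding XT N_def by blast
      moreover have "2 * (N choose s) \<le> fact (N - N div 2)"
        by (rule double_binomial_le_fact_half[OF N8 s4])
      ultimately have "2 * (N choose s) * card (fixer T) \<le> fact N"
        by (subst mult.commute) (rule order_trans[OF mult_le_mono2])
      hence False using bound[of "card (fixer T)"] card_le_fact_fixer[OF invT] by (simp add: t_def)
      thus ?thesis ..
    next
      case d1: False
      \<comment> \<open>The third point of a linking three-cycle belongs to the same class, so no
        class has exactly two points.\<close>
      have "d \<ge> 3"
      proof -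
        have "cls x0 \<noteq> {x0}" using d1 by (auto simp: d_def)
        then obtain y where y: "linked x0 y" "y \<noteq> x0" using linked_refl by (auto simp: cls_def)
        then obtain z where z: "distinct [x0, y, z]" "three_cycle x0 y z \<in> H" by (auto simp: linked_def)
        have "linked x0 z" using three_cycle_perms(3)[OF z(2,1)] z(1) by (auto simp: linked_def)
        hence "{x0, y, z} \<subseteq> cls x0" using y linked_refl by (auto simp: cls_def)
        hence "card {x0, y, z} \<le> d"
          using clsZ[OF x0] fZ unfolding d_def by (intro card_mono) (auto intro: finite_subset)
        thus ?thesis using z(1) by simp
      qed
      hence "2 * (N choose s) * (fact r * fact d ^ r) \<le> fact N"
        using double_binomial_le_equipartitions[of r d s] r2 N8 s4 unfolding Nrd by simp
      \<comment> \<open>The blocks fill the orbit, so the last factor is \<open>fact t\<close>, as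
        \<open>bound\<close> expects.\<close>
      moreover have "card H \<le> fact r * fact d ^ r * fact (card X - r * d)"
      proof (rule card_le_block_preserving[OF perm_group_axioms fB])
        show "card \<B> = r" by (simp add: r_def)
        show "b \<subseteq> X \<and> card b = d" if "b \<in> \<B>" for b
          using that clsZ ZX card_cls by (auto simp: \<B>_def)
        show "pairwise disjnt \<B>" by (rule disj)
        show "p ` b \<in> \<B>" if "p \<in> H" "b \<in> \<B>" for p b
          using that cls_image Z(1) by (auto simp: \<B>_def invariant_def)
      qed
      ultimately have False
        using bound[of "fact r * fact d ^ r"] t by (simp add: n_def Nrd ac_simps)
      thus ?thesis ..
    qed
  qed
qed

end

section \<open>Perfect matchings with prescribed crossing number\<close>

definition perfect_matchings :: "'a set \<Rightarrow> 'a set set set" where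
  "perfect_matchings U = {M. (\<forall>e\<in>M. card e = 2) \<and> pairwise disjnt M \<and> \<Union>M = U}"

definition crossing :: "'a set \<Rightarrow> 'a set set \<Rightarrow> nat" where
  "crossing A M = card {e \<in> M. card (e \<inter> A) = 1}"

lemma perfect_matchings_empty: "perfect_matchings {} = {{}}"
proof -
  have "M = {}" if "\<forall>e\<in>M. card e = 2" "\<Union>M = {}" for M :: "'a set set"
    using that by (metis Union_empty_conv card.empty ex_in_conv zero_neq_numeral)
  thus ?thesis by (auto simp: perfect_matchings_def)
qed

lemma finite_perfect_matching:
  assumes "finite U" "M \<in> perfect_matchings U" shows "finite M" "e \<in> M \<Longrightarrow> finite e"
  using assms by (auto simp: perfect_matchings_def intro: finite_UnionD card_ge_0_finite)

lemma finite_perfect_matchings: "finite U \<Longrightarrow> finite (perfect_matchings U)"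
  by (rule finite_subset[of _ "Pow (Pow U)"]) (auto simp: perfect_matchings_def)

lemma insert_perfect_matching:
  assumes "M \<in> perfect_matchings (U - {v, w})" "v \<in> U" "w \<in> U" "v \<noteq> w"
  shows "insert {v, w} M \<in> perfect_matchings U" "{v, w} \<notin> M"
proof -
  have U: "\<Union>M = U - {v, w}" using assms(1) by (simp add: perfect_matchings_def)
  hence "\<forall>e\<in>M. e \<inter> {v, w} = {}" by blast
  thus "{v, w} \<notin> M" "insert {v, w} M \<in> perfect_matchings U"
    using assms U by (auto simp: perfect_matchings_def pairwise_insert disjnt_def)
qed

lemma perfect_matching_decomp:
  assumes "M \<in> perfect_matchings U" "v \<in> U"
  obtains w where "w \<in> U - {v}" "{v, w} \<in> M" "M - {{v, w}} \<in> perfect_matchings (U - {v, w})"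
proof -
  obtain e where e: "e \<in> M" "v \<in> e" using assms by (auto simp: perfect_matchings_def)
  have "card e = 2" using assms e by (auto simp: perfect_matchings_def)
  then obtain w where w: "e = {v, w}" "w \<noteq> v"
    using e(2) by (auto simp: card_2_iff)
  have "f \<inter> {v, w} = {}" if "f \<in> M - {e}" for f
    using assms e w that by (auto simp: perfect_matchings_def pairwise_def disjnt_def)
  hence "\<Union>(M - {e}) = U - {v, w}"
    using assms e w by (auto simp: perfect_matchings_def)
  hence "M - {e} \<in> perfect_matchings (U - {v, w})"
    using assms by (auto simp: perfect_matchings_def pairwise_def)
  moreover have "w \<in> U" using assms e w by (auto simp: perfect_matchings_def)
  ultimately show thesis using that[of w] e w by auto
qed

lemma sum_perfect_matchings:
  assumes "finite U" "v \<in> U"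
  shows "(\<Sum>M\<in>perfect_matchings U. f M)
    = (\<Sum>w\<in>U - {v}. \<Sum>M\<in>perfect_matchings (U - {v, w}). f (insert {v, w} M))"
proof -
  let ?S = "Sigma (U - {v}) (\<lambda>w. perfect_matchings (U - {v, w}))"
  let ?h = "\<lambda>q. insert {v, fst q} (snd q)"
  have inj: "inj_on ?h ?S"
  proof (rule inj_onI)
    fix q q' assume q: "q \<in> ?S" "q' \<in> ?S" and eq: "?h q = ?h q'"
    have nv: "e \<notin> snd q" "e \<notin> snd q'" if "v \<in> e" for e
      using q that by (auto simp: perfect_matchings_def)
    have "{v, fst q} = {v, fst q'}" using eq nv(2)[of "{v, fst q}"] by auto
    hence 1: "fst q = fst q'" using q by (auto simp: doubleton_eq_iff)
    have "snd q = ?h q - {{v, fst q}}" using nv(1)[of "{v, fst q}"] by simp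
    also have "\<dots> = ?h q' - {{v, fst q'}}" by (subst eq) (simp only: 1)
    also have "\<dots> = snd q'" using nv(2)[of "{v, fst q'}"] by simp
    finally show "q = q'" using 1 by (simp add: prod_eq_iff)
  qed
  have img: "?h ` ?S = perfect_matchings U"
  proof
    show "?h ` ?S \<subseteq> perfect_matchings U"
    proof
      fix M assume "M \<in> ?h ` ?S"
      then obtain q where q: "q \<in> ?S" "M = ?h q" by blast
      hence "snd q \<in> perfect_matchings (U - {v, fst q})" "fst q \<in> U" "v \<noteq> fst q" by auto
      thus "M \<in> perfect_matchings U"
        using insert_perfect_matching(1)[OF _ assms(2)] unfolding q(2) by blast
    qed
    show "perfect_matchings U \<subseteq> ?h ` ?S"
    proof
      fix M assume "M \<in> perfect_matchings U"
      from perfect_matching_decomp[OF this assms(2)] obtain w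
        where w: "w \<in> U - {v}" "{v, w} \<in> M" "M - {{v, w}} \<in> perfect_matchings (U - {v, w})" .
      hence "(w, M - {{v, w}}) \<in> ?S" "M = ?h (w, M - {{v, w}})" by auto
      thus "M \<in> ?h ` ?S" by (rule rev_image_eqI)
    qed
  qed
  have "(\<Sum>M\<in>perfect_matchings U. f M) = (\<Sum>(w, M)\<in>?S. f (insert {v, w} M))"
    using sum.reindex[OF inj, of f] unfolding img by (simp add: split_def comp_def)
  also have "\<dots> = (\<Sum>w\<in>U - {v}. \<Sum>M\<in>perfect_matchings (U - {v, w}). f (insert {v, w} M))"
    using assms(1) by (subst sum.Sigma) (auto intro: finite_perfect_matchings)
  finally show ?thesis .
qed

lemma crossing_insert:
  assumes "finite U" "M \<in> perfect_matchings (U - {v, w})" "v \<in> U" "w \<in> U" "v \<noteq> w"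
  shows "crossing A (insert {v, w} M) = crossing A M + (if (v \<in> A) \<noteq> (w \<in> A) then 1 else 0)"
proof -
  have n: "{v, w} \<notin> M" by (rule insert_perfect_matching(2)[OF assms(2-5)])
  have f: "finite M" by (rule finite_perfect_matching(1)[OF _ assms(2)]) (use assms(1) in simp)
  have "card ({v, w} \<inter> A) = 1 \<longleftrightarrow> (v \<in> A) \<noteq> (w \<in> A)"
    using assms(5) by (cases "v \<in> A"; cases "w \<in> A") auto
  hence "{e \<in> insert {v, w} M. card (e \<inter> A) = 1}
    = (if (v \<in> A) \<noteq> (w \<in> A) then insert {v, w} {e \<in> M. card (e \<inter> A) = 1} else {e \<in> M. card (e \<inter> A) = 1})"
    by auto
  thus ?thesis using n f by (auto simp: crossing_def)
qed

lemma crossing_Compl: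
  assumes "M \<in> perfect_matchings U" shows "crossing (- A) M = crossing A M"
proof -
  have "card (e \<inter> - A) = 1 \<longleftrightarrow> card (e \<inter> A) = 1" if "e \<in> M" for e
  proof -
    have e: "card e = 2" using assms that by (auto simp: perfect_matchings_def)
    hence "card e = card (e \<inter> A) + card (e \<inter> - A)"
      by (metis card.infinite card_Int_Diff diff_eq zero_neq_numeral)
    thus ?thesis using e by auto
  qed
  thus ?thesis by (auto simp: crossing_def intro: arg_cong[where f = card])
qed

text \<open>Each edge inside \<open>A\<close> contributes two points of \<open>A\<close>, each
  crossing edge one. Consequently the number of inside edges is an affine function of the crossing
  number.\<close>

lemma card_eq_inside_crossing:
  assumes "finite U" "M \<in> perfect_matchings U"
  shows "card (U \<inter> A) = 2 * card {e \<in> M. e \<subseteq> A} + crossing A M"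
proof -
  have fM: "finite M" by (rule finite_perfect_matching[OF assms])
  have two: "card e = 2" "finite e" if "e \<in> M" for e
    using assms that by (auto simp: perfect_matchings_def intro: card_ge_0_finite)
  have "U \<inter> A = (\<Union>e\<in>M. e \<inter> A)" using assms by (auto simp: perfect_matchings_def)
  also have "card \<dots> = (\<Sum>e\<in>M. card (e \<inter> A))"
  proof (rule card_UN_disjoint[OF fM])
    show "\<forall>e\<in>M. \<forall>f\<in>M. e \<noteq> f \<longrightarrow> (e \<inter> A) \<inter> (f \<inter> A) = {}"
      using assms(2) unfolding perfect_matchings_def pairwise_def disjnt_def by blast
  qed (use two in auto)
  also have "\<dots> = (\<Sum>e\<in>M. (if e \<subseteq> A then 2 else 0) + (if card (e \<inter> A) = 1 then 1 else 0))"
  proof (rule sum.cong)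
    fix e assume "e \<in> M"
    then obtain v w where "e = {v, w}" "v \<noteq> w" using two by (meson card_2_iff)
    thus "card (e \<inter> A) = (if e \<subseteq> A then 2 else 0) + (if card (e \<inter> A) = 1 then 1 else 0)"
      by (cases "v \<in> A"; cases "w \<in> A") auto
  qed simp
  also have "\<dots> = 2 * card {e \<in> M. e \<subseteq> A} + crossing A M"
    using fM by (simp add: sum.distrib crossing_def flip: sum.inter_filter)
  finally show ?thesis .
qed

lemma crossing_le: "finite U \<Longrightarrow> M \<in> perfect_matchings U \<Longrightarrow> crossing A M \<le> card (U \<inter> A)"
  using card_eq_inside_crossing by fastforce

text \<open>The product of every second number down from \<open>n\<close>. For even \<open>m\<close>
  the quotient \<open>fact m / double_fact m\<close> is the number of perfect matchings of
  \<open>m\<close> points, which is how it enters the weights below.\<close>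

fun double_fact :: "nat \<Rightarrow> nat" where
  "double_fact 0 = 1"
| "double_fact (Suc 0) = 1"
| "double_fact (Suc (Suc n)) = Suc (Suc n) * double_fact n"

text \<open>With \<open>a = card (U \<inter> A)\<close> and \<open>b = card (U - A)\<close>, there are \<open>fact a * fact b / cross_weight A U i\<close>
  perfect matchings of \<open>U\<close> with \<open>i\<close> crossing edges.\<close>

definition cross_weight :: "'a set \<Rightarrow> 'a set \<Rightarrow> nat \<Rightarrow> real" where
  "cross_weight A U i = fact i * double_fact (card (U \<inter> A) - i) * double_fact (card (U - A) - i)"

text \<open>For admissible \<open>i\<close> this is the mean of \<open>g\<close> over the matchings
  with \<open>i\<close> crossing edges, times \<open>fact a * fact b\<close>. Keeping these
  factorials makes the coefficients of the recursion below linear in \<open>i\<close>.\<close>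

definition cross_sum :: "'a set \<Rightarrow> 'a set \<Rightarrow> nat \<Rightarrow> ('a set set \<Rightarrow> real) \<Rightarrow> real" where
  "cross_sum A U i g = cross_weight A U i * (\<Sum>M\<in>perfect_matchings U. if crossing A M = i then g M else 0)"

text \<open>The crossing numbers that occur. The bounds accompany the parities because a truncated
  difference \<open>0\<close> would count as even.\<close>

definition admissible :: "'a set \<Rightarrow> 'a set \<Rightarrow> nat \<Rightarrow> bool" where
  "admissible A U i \<longleftrightarrow> i \<le> card (U \<inter> A) \<and> i \<le> card (U - A)
     \<and> even (card (U \<inter> A) - i) \<and> even (card (U - A) - i)"

lemma cross_sum_Compl: "cross_sum (- A) U i g = cross_sum A U i g"
proof -
  have "U \<inter> - A = U - A" "U - - A = U \<inter> A" by auto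
  moreover have "(\<Sum>M\<in>perfect_matchings U. if crossing (- A) M = i then g M else 0)
    = (\<Sum>M\<in>perfect_matchings U. if crossing A M = i then g M else 0)"
    by (rule sum.cong) (auto simp: crossing_Compl)
  ultimately show ?thesis by (simp add: cross_sum_def cross_weight_def)
qed

lemma admissible_Compl: "admissible (- A) U i \<longleftrightarrow> admissible A U i"
proof -
  have "U \<inter> - A = U - A" "U - - A = U \<inter> A" by auto
  thus ?thesis by (auto simp: admissible_def)
qed

text \<open>Sort by the partner \<open>w\<close> of \<open>v\<close>. A partner outside
  \<open>A\<close> lowers \<open>i\<close> and both side sizes by one, so the weight loses the
  factor \<open>i\<close> of \<open>fact i\<close>. A partner inside \<open>A\<close> lowers only
  the size of \<open>U \<inter> A\<close>, by two, and the first double factorial loses the factor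
  \<open>card (U \<inter> A) - i\<close>.\<close>

lemma cross_sum_rec:
  assumes fin: "finite U" and v: "v \<in> U" "v \<in> A" and adm: "admissible A U i"
  shows "cross_sum A U i g =
     (\<Sum>w\<in>U - A. real i * cross_sum A (U - {v, w}) (i - 1) (\<lambda>M. g (insert {v, w} M)))
   + (\<Sum>w\<in>U \<inter> A - {v}. (real (card (U \<inter> A)) - real i) * cross_sum A (U - {v, w}) i (\<lambda>M. g (insert {v, w} M)))"
proof -
  let ?W = "cross_weight A U i"
  let ?f = "\<lambda>w. \<Sum>M\<in>perfect_matchings (U - {v, w}). if crossing A (insert {v, w} M) = i then g (insert {v, w} M) else 0"
  have split: "U - {v} = (U - A) \<union> (U \<inter> A - {v})" using v by auto
  have "cross_sum A U i g = (\<Sum>w\<in>U - {v}. ?W * ?f w)"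
    unfolding cross_sum_def sum_perfect_matchings[OF fin v(1)] by (simp add: sum_distrib_left)
  also have "\<dots> = (\<Sum>w\<in>U - A. ?W * ?f w) + (\<Sum>w\<in>U \<inter> A - {v}. ?W * ?f w)"
    unfolding split using fin by (intro sum.union_disjoint) auto
  also have "(\<Sum>w\<in>U - A. ?W * ?f w) =
      (\<Sum>w\<in>U - A. real i * cross_sum A (U - {v, w}) (i - 1) (\<lambda>M. g (insert {v, w} M)))"
  proof (rule sum.cong)
    fix w assume w: "w \<in> U - A"
    hence vw: "w \<in> U" "v \<noteq> w" using v by auto
    have cr: "crossing A (insert {v, w} M) = Suc (crossing A M)" if "M \<in> perfect_matchings (U - {v, w})" for M
      using crossing_insert[OF fin that v(1) vw, of A] w v by auto
    show "?W * ?f w = real i * cross_sum A (U - {v, w}) (i - 1) (\<lambda>M. g (insert {v, w} M))"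
    proof (cases i)
      case 0
      thus ?thesis using cr by simp
    next
      case (Suc j)
      have "(U - {v, w}) \<inter> A = (U \<inter> A) - {v}" "(U - {v, w}) - A = (U - A) - {w}" using w v by auto
      hence c: "card ((U - {v, w}) \<inter> A) = card (U \<inter> A) - 1" "card ((U - {v, w}) - A) = card (U - A) - 1"
        using w v fin by auto
      have "?W = real i * cross_weight A (U - {v, w}) (i - 1)"
        unfolding cross_weight_def c Suc by (simp add: algebra_simps)
      moreover have "?f w = (\<Sum>M\<in>perfect_matchings (U - {v, w}). if crossing A M = i - 1 then g (insert {v, w} M) else 0)"
        by (rule sum.cong) (auto simp: cr Suc)
      ultimately show ?thesis by (simp add: cross_sum_def)
    qed
  qed simp
  also have "(\<Sum>w\<in>U \<inter> A - {v}. ?W * ?f w) =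
      (\<Sum>w\<in>U \<inter> A - {v}. (real (card (U \<inter> A)) - real i) * cross_sum A (U - {v, w}) i (\<lambda>M. g (insert {v, w} M)))"
  proof (rule sum.cong)
    fix w assume w: "w \<in> U \<inter> A - {v}"
    hence vw: "w \<in> U" "v \<noteq> w" by auto
    have cr: "crossing A (insert {v, w} M) = crossing A M" if "M \<in> perfect_matchings (U - {v, w})" for M
      using crossing_insert[OF fin that v(1) vw, of A] w v by auto
    have f: "?f w = (\<Sum>M\<in>perfect_matchings (U - {v, w}). if crossing A M = i then g (insert {v, w} M) else 0)"
      by (rule sum.cong) (auto simp: cr)
    have "(U - {v, w}) \<inter> A = (U \<inter> A) - {v, w}" "(U - {v, w}) - A = U - A" using w v by auto
    hence c: "card ((U - {v, w}) \<inter> A) = card (U \<inter> A) - 2" "card ((U - {v, w}) - A) = card (U - A)"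
      using card_Diff_subset[of "{v, w}" "U \<inter> A"] w v vw by simp_all
    have "card {v, w} \<le> card (U \<inter> A)" using w v fin by (intro card_mono) auto
    hence a2: "card (U \<inter> A) \<ge> 2" using vw by simp
    show "?W * ?f w = (real (card (U \<inter> A)) - real i) * cross_sum A (U - {v, w}) i (\<lambda>M. g (insert {v, w} M))"
    proof (cases "i = card (U \<inter> A)")
      case True
      \<comment> \<open>Only \<open>i - 2\<close> points of \<open>A\<close> remain, too few for
        \<open>i\<close> crossing edges.\<close>
      have "crossing A M \<noteq> i" if "M \<in> perfect_matchings (U - {v, w})" for M
        using crossing_le[OF _ that, of A] fin c a2 True by auto
      hence "?f w = 0" unfolding f by (intro sum.neutral) auto
      thus ?thesis using True by simp
    next
      case False
      \<comment> \<open>Parity excludes the difference \<open>1\<close>, so the double factorial can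
        be unfolded once.\<close>
      have "even (card (U \<inter> A) - i)" "card (U \<inter> A) - i \<noteq> 0"
        using adm False by (auto simp: admissible_def)
      then obtain m where m: "card (U \<inter> A) - i = Suc (Suc m)"
        by (metis even_Suc not0_implies_Suc even_zero)
      hence m': "card (U \<inter> A) - 2 - i = m" "real (card (U \<inter> A)) - real i = real (Suc (Suc m))" by linarith+
      have "?W = (real (card (U \<inter> A)) - real i) * cross_weight A (U - {v, w}) i"
        unfolding cross_weight_def c m m' by (simp add: algebra_simps)
      thus ?thesis by (simp add: cross_sum_def f)
    qed
  qed simp
  finally show ?thesis .
qed

lemma admissible_remove_crossing:
  assumes "finite U" "v \<in> U \<inter> A" "w \<in> U - A" "admissible A U i" "i \<noteq> 0"
  shows "admissible A (U - {v, w}) (i - 1)"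
    "card ((U - {v, w}) \<inter> A) = card (U \<inter> A) - 1" "card ((U - {v, w}) - A) = card (U - A) - 1"
proof -
  have "(U - {v, w}) \<inter> A = (U \<inter> A) - {v}" "(U - {v, w}) - A = (U - A) - {w}" using assms by auto
  thus c: "card ((U - {v, w}) \<inter> A) = card (U \<inter> A) - 1" "card ((U - {v, w}) - A) = card (U - A) - 1"
    using assms(1-3) by auto
  show "admissible A (U - {v, w}) (i - 1)"
    using assms(4,5) unfolding admissible_def c by auto
qed

lemma admissible_remove_inside:
  assumes "finite U" "v \<in> U \<inter> A" "w \<in> U \<inter> A - {v}" "admissible A U i" "i \<noteq> card (U \<inter> A)"
  shows "admissible A (U - {v, w}) i"
    "card ((U - {v, w}) \<inter> A) = card (U \<inter> A) - 2" "card ((U - {v, w}) - A) = card (U - A)"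
proof -
  have "(U - {v, w}) \<inter> A = (U \<inter> A) - {v, w}" "(U - {v, w}) - A = U - A" using assms by auto
  moreover have "card {v, w} = 2" using assms(3) by auto
  ultimately show c: "card ((U - {v, w}) \<inter> A) = card (U \<inter> A) - 2" "card ((U - {v, w}) - A) = card (U - A)"
    using card_Diff_subset[of "{v, w}" "U \<inter> A"] assms(2,3) by simp_all
  have *: "i \<le> a - 2 \<and> even (a - 2 - i)" if a: "even (a - i)" "i \<le> a" "i \<noteq> a" for a
  proof -
    obtain j where "a - i = 2 * j" using a(1) by (rule evenE)
    hence "a - 2 = i + 2 * (j - 1)" using a by (cases j) auto
    thus ?thesis by simp
  qed
  have adm: "i \<le> card (U \<inter> A)" "i \<le> card (U - A)" "even (card (U \<inter> A) - i)" "even (card (U - A) - i)"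
    using assms(4) unfolding admissible_def by blast+
  show "admissible A (U - {v, w}) i"
    unfolding admissible_def c using *[OF adm(3,1) assms(5)] adm(2,4) by blast
qed

text \<open>This is the count of matchings behind \<open>cross_weight\<close>. In the recursion the
  crossing partners contribute the share \<open>i / a\<close> and the inside partners
  \<open>(a - i) / a\<close>, where \<open>a = card (U \<inter> A)\<close>.\<close>

lemma cross_sum_one:
  assumes "finite U" "admissible A U i"
  shows "cross_sum A U i (\<lambda>_. 1) = fact (card (U \<inter> A)) * fact (card (U - A))"
  using assms
proof (induction U arbitrary: A i rule: finite_psubset_induct)
  case (psubset U)
  have step: "cross_sum A U i (\<lambda>_. 1) = fact (card (U \<inter> A)) * fact (card (U - A))"
    if v: "v \<in> U \<inter> A" and adm: "admissible A U i" for A v i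
  proof -
    let ?a = "card (U \<inter> A)" and ?b = "card (U - A)"
    have ib: "i \<le> ?b" "i \<le> ?a" using adm by (auto simp: admissible_def)
    have a0: "?a \<noteq> 0" using v psubset.hyps by auto
    have 1: "real i * cross_sum A (U - {v, w}) (i - 1) (\<lambda>_. 1) = real i * (fact (?a - 1) * fact (?b - 1))"
      if w: "w \<in> U - A" for w
    proof (cases "i = 0")
      case False
      note r = admissible_remove_crossing[OF psubset.hyps v w adm False]
      have "U - {v, w} \<subset> U" using v by auto
      from psubset.IH[OF this r(1)] show ?thesis unfolding r(2,3) by simp
    qed simp
    have 2: "(real ?a - real i) * cross_sum A (U - {v, w}) i (\<lambda>_. 1) = (real ?a - real i) * (fact (?a - 2) * fact ?b)"
      if w: "w \<in> U \<inter> A - {v}" for w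
    proof (cases "i = ?a")
      case False
      note r = admissible_remove_inside[OF psubset.hyps v w adm False]
      have "U - {v, w} \<subset> U" using v by auto
      from psubset.IH[OF this r(1)] show ?thesis unfolding r(2,3) by simp
    qed simp
    have "cross_sum A U i (\<lambda>_. 1) = real ?b * (real i * (fact (?a - 1) * fact (?b - 1)))
        + real (?a - 1) * ((real ?a - real i) * (fact (?a - 2) * fact ?b))"
    proof -
      have "card (U \<inter> A - {v}) = ?a - 1" using v by simp
      moreover have "cross_sum A U i (\<lambda>_. 1) = (\<Sum>w\<in>U - A. real i * (fact (?a - 1) * fact (?b - 1)))
          + (\<Sum>w\<in>U \<inter> A - {v}. (real ?a - real i) * (fact (?a - 2) * fact ?b))"
        by (subst cross_sum_rec[OF psubset.hyps _ _ adm, of v])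
          (use v in \<open>auto simp only: sum.cong[OF refl 1] sum.cong[OF refl 2]\<close>)
      ultimately show ?thesis by simp
    qed
    also have "real ?b * (real i * (fact (?a - 1) * fact (?b - 1))) = real i * fact (?a - 1) * fact ?b"
    proof (cases ?b)
      case 0 thus ?thesis using ib by simp
    next
      case (Suc b) thus ?thesis by simp
    qed
    also have "real (?a - 1) * ((real ?a - real i) * (fact (?a - 2) * fact ?b))
        = (real ?a - real i) * fact (?a - 1) * fact ?b"
    proof (cases "?a - 1")
      \<comment> \<open>For \<open>a = 1\<close> parity forces \<open>i = 1\<close>, so the
        right-hand side vanishes as well.\<close>
      case 0
      hence "?a = 1" using a0 by simp
      moreover have "even (?a - i)" using adm unfolding admissible_def by blast
      ultimately have "i = ?a" using ib by (cases i) auto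
      thus ?thesis by simp
    next
      case (Suc c)
      hence "?a - 2 = c" by simp
      thus ?thesis using Suc by simp
    qed
    also have "real i * fact (?a - 1) * fact ?b + (real ?a - real i) * fact (?a - 1) * fact ?b
        = (real ?a * fact (?a - 1)) * fact ?b"
      by (simp add: algebra_simps)
    also have "real ?a * fact (?a - 1) = fact ?a" using a0 by (simp add: fact_reduce)
    finally show ?thesis .
  qed
  show ?case
  proof (cases "U = {}")
    case True
    thus ?thesis using psubset.prems
      by (simp add: cross_sum_def cross_weight_def perfect_matchings_empty crossing_def admissible_def)
  next
    case False
    then obtain v where v: "v \<in> U" by auto
    show ?thesis
    proof (cases "v \<in> A")
      case True thus ?thesis using step[of v A i] v psubset.prems by auto
    next
      case False
      have "U \<inter> - A = U - A" "U - - A = U \<inter> A" by auto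
      thus ?thesis using step[of v "- A" i] v psubset.prems False
        by (simp add: cross_sum_Compl admissible_Compl)
    qed
  qed
qed

section \<open>Functions determined by the edges at few vertices\<close>

definition edges_at :: "'a set \<Rightarrow> 'a set set \<Rightarrow> 'a set set" where
  "edges_at S M = {e \<in> M. e \<inter> S \<noteq> {}}"

definition depends_at :: "'a set \<Rightarrow> 'a set \<Rightarrow> ('a set set \<Rightarrow> real) \<Rightarrow> bool" where
  "depends_at U S g \<longleftrightarrow> (\<forall>M\<in>perfect_matchings U. \<forall>M'\<in>perfect_matchings U.
     edges_at S M = edges_at S M' \<longrightarrow> g M = g M')"

text \<open>Once the edge at \<open>v\<close> is fixed, the rest of the matching has no edge at
  \<open>v\<close>. Each removal therefore uses up one vertex of \<open>S\<close>, which bounds the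
  degree by \<open>card S\<close>.\<close>

lemma depends_at_insert:
  assumes "depends_at U S g" "v \<in> U" "w \<in> U" "v \<noteq> w"
  shows "depends_at (U - {v, w}) (S - {v}) (\<lambda>M. g (insert {v, w} M))"
  unfolding depends_at_def
proof (intro ballI impI)
  fix M M' assume M: "M \<in> perfect_matchings (U - {v, w})" "M' \<in> perfect_matchings (U - {v, w})"
    and eq: "edges_at (S - {v}) M = edges_at (S - {v}) M'"
  have "edges_at S N = edges_at (S - {v}) N" if "N \<in> perfect_matchings (U - {v, w})" for N
  proof -
    have "\<Union>N = U - {v, w}" using that by (simp add: perfect_matchings_def)
    thus ?thesis by (auto simp: edges_at_def)
  qed
  hence "edges_at S M = edges_at S M'" using M eq by simp
  moreover have "edges_at S (insert e N) = (if e \<inter> S \<noteq> {} then {e} else {}) \<union> edges_at S N" for e N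
    by (auto simp: edges_at_def)
  ultimately have "edges_at S (insert {v, w} M) = edges_at S (insert {v, w} M')" by simp
  moreover have "insert {v, w} M \<in> perfect_matchings U" "insert {v, w} M' \<in> perfect_matchings U"
    using insert_perfect_matching(1)[OF _ assms(2-4)] M by blast+
  ultimately show "g (insert {v, w} M) = g (insert {v, w} M')"
    using assms(1) unfolding depends_at_def by blast
qed

text \<open>Removing the edge at \<open>v \<in> S \<inter> A\<close> yields a factor \<open>i\<close> if this edge is crossing and
  \<open>card (U \<inter> A) - i\<close> otherwise.  The former vanishes at \<open>i = 0\<close> and the latter is nonnegative there,
  so the value at \<open>0\<close> is nonnegative even if no matching has \<open>0\<close> crossing edges.\<close>

lemma cross_sum_poly:
  assumes "finite U" "finite S" "\<And>M. M \<in> perfect_matchings U \<Longrightarrow> g M \<ge> 0" "depends_at U S g"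
  shows "\<exists>p :: real poly. degree p \<le> card S \<and> poly p 0 \<ge> 0 \<and>
     (\<forall>i. admissible A U i \<longrightarrow> cross_sum A U i g = poly p (real i))"
  using assms
proof (induction "card S" arbitrary: U S g A rule: less_induct)
  case less
  show ?case
  \<comment> \<open>If no edge meets \<open>S\<close>, then \<open>g\<close> is constant and
    \<open>cross_sum_one\<close> provides a constant polynomial.\<close>
  proof (cases "S \<inter> U = {}")
    case True
    have "edges_at S M = {}" if "M \<in> perfect_matchings U" for M
      using that True by (auto simp: edges_at_def perfect_matchings_def)
    hence const: "g M = g M'" if "M \<in> perfect_matchings U" "M' \<in> perfect_matchings U" for M M'
      using less.prems(4) that unfolding depends_at_def by metis
    obtain c where c: "c \<ge> 0" "\<And>M. M \<in> perfect_matchings U \<Longrightarrow> g M = c"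
    proof (cases "perfect_matchings U = {}")
      case True thus thesis using that[of 0] by simp
    next
      case False
      then obtain M where M: "M \<in> perfect_matchings U" by blast
      show thesis
        by (rule that[of "g M"]) (use M const less.prems(3) in blast)+
    qed
    let ?p = "[:c * (fact (card (U \<inter> A)) * fact (card (U - A))):]"
    have "cross_sum A U i g = poly ?p (real i)" if "admissible A U i" for i
    proof -
      have "cross_sum A U i g = c * cross_sum A U i (\<lambda>_. 1)"
        unfolding cross_sum_def by (simp add: sum_distrib_left c(2) if_distrib mult.commute cong: if_cong)
      thus ?thesis using cross_sum_one[OF less.prems(1) that] by simp
    qed
    moreover have "poly ?p 0 \<ge> 0" "degree ?p \<le> card S" using c(1) by simp_all
    ultimately show ?thesis by blast
  next
    case False
    then obtain v where v: "v \<in> S" "v \<in> U" by auto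
    have smaller: "card (S - {v}) < card S" using v less.prems(2) by (meson card_Diff1_less)
    have step: "\<exists>p :: real poly. degree p \<le> card S \<and> poly p 0 \<ge> 0 \<and>
     (\<forall>i. admissible A U i \<longrightarrow> cross_sum A U i g = poly p (real i))" if vA: "v \<in> A" for A
    proof -
      have "\<forall>w\<in>U - {v}. \<exists>p :: real poly. degree p \<le> card (S - {v}) \<and> poly p 0 \<ge> 0 \<and>
        (\<forall>i. admissible A (U - {v, w}) i \<longrightarrow> cross_sum A (U - {v, w}) i (\<lambda>M. g (insert {v, w} M)) = poly p (real i))"
      proof
        fix w assume w: "w \<in> U - {v}"
        hence vw: "w \<in> U" "v \<noteq> w" by auto
        show "\<exists>p :: real poly. degree p \<le> card (S - {v}) \<and> poly p 0 \<ge> 0 \<and>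
        (\<forall>i. admissible A (U - {v, w}) i \<longrightarrow> cross_sum A (U - {v, w}) i (\<lambda>M. g (insert {v, w} M)) = poly p (real i))"
        proof (rule less.hyps[OF smaller])
          show "g (insert {v, w} M) \<ge> 0" if "M \<in> perfect_matchings (U - {v, w})" for M
            using insert_perfect_matching(1)[OF that v(2) vw] less.prems(3) by blast
          show "depends_at (U - {v, w}) (S - {v}) (\<lambda>M. g (insert {v, w} M))"
            by (rule depends_at_insert[OF less.prems(4) v(2) vw])
        qed (use less.prems in auto)
      qed
      from bchoice[OF this] obtain P :: "'a \<Rightarrow> real poly" where P0: "\<forall>w\<in>U - {v}. degree (P w) \<le> card (S - {v})
        \<and> poly (P w) 0 \<ge> 0 \<and> (\<forall>i. admissible A (U - {v, w}) i \<longrightarrow>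
          cross_sum A (U - {v, w}) i (\<lambda>M. g (insert {v, w} M)) = poly (P w) (real i))" ..
      have P: "\<And>w. w \<in> U - {v} \<Longrightarrow> degree (P w) \<le> card (S - {v})"
        "\<And>w. w \<in> U - {v} \<Longrightarrow> poly (P w) 0 \<ge> 0"
        "\<And>w i. w \<in> U - {v} \<Longrightarrow> admissible A (U - {v, w}) i \<Longrightarrow>
          cross_sum A (U - {v, w}) i (\<lambda>M. g (insert {v, w} M)) = poly (P w) (real i)"
        using P0 by blast+
      \<comment> \<open>The recursion read as a polynomial in \<open>i\<close>; the composition
        evaluates \<open>P w\<close> at \<open>i - 1\<close>. At \<open>i = 0\<close> this is the
        uncontrolled value at \<open>-1\<close>, which the factor \<open>[:0, 1:]\<close>
        cancels.\<close>
      define p where "p = (\<Sum>w\<in>U - A. [:0, 1:] * pcompose (P w) [:-1, 1:])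
        + (\<Sum>w\<in>U \<inter> A - {v}. [:real (card (U \<inter> A)), -1:] * P w)"
      have "degree p \<le> card S" unfolding p_def
      proof (intro degree_add_le degree_sum_le)
        fix w assume "w \<in> U - A"
        hence w: "w \<in> U - {v}" using vA by auto
        have "degree ([:0, 1:] * pcompose (P w) [:-1, 1:]) \<le> degree [:0, 1::real:] + degree (pcompose (P w) [:-1, 1:])"
          by (rule degree_mult_le)
        also have "\<dots> \<le> card S" using P(1)[OF w] smaller by (simp add: degree_pcompose)
        finally show "degree ([:0, 1:] * pcompose (P w) [:-1, 1:]) \<le> card S" .
      next
        fix w assume "w \<in> U \<inter> A - {v}"
        hence w: "w \<in> U - {v}" by auto
        have "degree ([:real (card (U \<inter> A)), -1:] * P w) \<le> degree [:real (card (U \<inter> A)), -1:] + degree (P w)"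
          by (rule degree_mult_le)
        also have "\<dots> \<le> card S" using P(1)[OF w] smaller by simp
        finally show "degree ([:real (card (U \<inter> A)), -1:] * P w) \<le> card S" .
      qed (use less.prems(1) in auto)
      moreover have "poly p 0 \<ge> 0" unfolding p_def
        using P(2) by (auto simp: poly_sum intro!: sum_nonneg mult_nonneg_nonneg)
      moreover have "cross_sum A U i g = poly p (real i)" if adm: "admissible A U i" for i
      proof -
        have 1: "real i * cross_sum A (U - {v, w}) (i - 1) (\<lambda>M. g (insert {v, w} M))
          = poly ([:0, 1:] * pcompose (P w) [:-1, 1:]) (real i)" if w: "w \<in> U - A" for w
        proof (cases "i = 0")
          case False
          have "admissible A (U - {v, w}) (i - 1)"
            using admissible_remove_crossing(1)[OF less.prems(1) _ w adm False] v vA by auto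
          moreover have "w \<in> U - {v}" using w vA by auto
          ultimately have "cross_sum A (U - {v, w}) (i - 1) (\<lambda>M. g (insert {v, w} M)) = poly (P w) (real (i - 1))"
            using P(3) by blast
          moreover have "real (i - 1) = - 1 + real i" using False by (simp add: of_nat_diff)
          ultimately show ?thesis by (simp add: poly_pcompose)
        qed simp
        have 2: "(real (card (U \<inter> A)) - real i) * cross_sum A (U - {v, w}) i (\<lambda>M. g (insert {v, w} M))
          = poly ([:real (card (U \<inter> A)), -1:] * P w) (real i)" if w: "w \<in> U \<inter> A - {v}" for w
        proof (cases "i = card (U \<inter> A)")
          case False
          have "admissible A (U - {v, w}) i"
            using admissible_remove_inside(1)[OF less.prems(1) _ w adm False] v vA by auto
          moreover have "w \<in> U - {v}" using w by auto
          ultimately have "cross_sum A (U - {v, w}) i (\<lambda>M. g (insert {v, w} M)) = poly (P w) (real i)"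
            using P(3) by blast
          thus ?thesis by (simp add: algebra_simps)
        qed simp
        show ?thesis
          unfolding cross_sum_rec[OF less.prems(1) v(2) vA adm] p_def poly_add poly_sum
          using 1 2 by (intro arg_cong2[where f = "(+)"] sum.cong) auto
      qed
      ultimately show ?thesis by blast
    qed
    show ?thesis
    proof (cases "v \<in> A")
      case True thus ?thesis by (rule step)
    next
      case False
      hence "v \<in> - A" by simp
      from step[OF this] show ?thesis by (simp add: cross_sum_Compl admissible_Compl)
    qed
  qed
qed

section \<open>Extrapolation to crossing number zero\<close>

lemma lagrange_extrapolation:
  fixes I :: "nat set" and x :: real
  assumes "finite I" "card I = Suc k"
  shows "\<exists>c :: nat \<Rightarrow> real. \<forall>p :: real poly. degree p \<le> k \<longrightarrow> (\<Sum>i\<in>I. c i * poly p (real i)) = poly p x"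
proof -
  define L :: "nat \<Rightarrow> real poly" where "L = (\<lambda>j. \<Prod>i\<in>I - {j}. [:- real i, 1:])"
  have L: "poly (L j) y = (\<Prod>i\<in>I - {j}. y - real i)" for j y
    by (simp add: L_def poly_prod)
  have degL: "degree (L j) \<le> k" if "j \<in> I" for j
  proof -
    have "degree (L j) \<le> sum (degree \<circ> (\<lambda>i. [:- real i, 1:])) (I - {j})"
      unfolding L_def by (rule degree_prod_sum_le) (use assms in simp)
    thus ?thesis using that assms by simp
  qed
  have Lne: "poly (L j) (real j) \<noteq> 0" for j unfolding L using assms by auto
  have L0: "poly (L j) (real i) = 0" if "i \<in> I" "i \<noteq> j" for i j
    unfolding L using that assms by (auto intro!: bexI[of _ i])
  have "(\<Sum>i\<in>I. poly (L i) x / poly (L i) (real i) * poly p (real i)) = poly p x" if p: "degree p \<le> k" for p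
  proof -
    define q where "q = (\<Sum>j\<in>I. smult (poly p (real j) / poly (L j) (real j)) (L j))"
    have "p = q"
    proof (rule poly_eqI_degree)
      fix y assume "y \<in> real ` I"
      then obtain i where i: "i \<in> I" "y = real i" by auto
      have "poly q y = (\<Sum>j\<in>I. if j = i then poly p (real i) else 0)"
        unfolding q_def poly_sum i(2) by (rule sum.cong) (use L0 Lne i in auto)
      thus "poly p y = poly q y" using i assms by simp
    next
      have c: "card (real ` I) = Suc k" using assms by (simp add: card_image)
      show "degree p < card (real ` I)" using p c by simp
      have "degree q \<le> k" unfolding q_def using degL assms
        by (intro degree_sum_le) (auto intro: order_trans[OF degree_smult_le])
      thus "degree q < card (real ` I)" using c by simp
    qed
    hence "poly p x = poly q x" by simp
    thus ?thesis by (simp add: q_def poly_sum mult.commute)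
  qed
  thus ?thesis by (intro exI[of _ "\<lambda>i. poly (L i) x / poly (L i) (real i)"]) auto
qed

text \<open>The weights imitate the uniform distribution on matchings without crossing edges, which
  do not exist because both sides are odd. On functions determined at \<open>k\<close> vertices they
  return the value at \<open>0\<close> of a polynomial known to be nonnegative there.
  \<open>k \<ge> 1\<close> lets the degree-one count of inside edges be extrapolated too.\<close>

lemma matching_pseudo_expectation:
  assumes fin: "finite U" and cA: "card (U \<inter> A) = 2 * k + 1" and cB: "card (U - A) = 2 * k + 1" and k: "k \<ge> 1"
  obtains c :: "'a set set \<Rightarrow> real"
  where "(\<Sum>M\<in>perfect_matchings U. c M) = 1"
    and "(\<Sum>M\<in>perfect_matchings U. c M * real (card {e \<in> M. e \<subseteq> A})) = real k + 1 / 2"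
    and "\<forall>S g. finite S \<longrightarrow> card S \<le> k \<longrightarrow> (\<forall>M\<in>perfect_matchings U. g M \<ge> 0) \<longrightarrow>
      depends_at U S g \<longrightarrow> (\<Sum>M\<in>perfect_matchings U. c M * g M) \<ge> 0"
proof -
  \<comment> \<open>The \<open>k + 1\<close> odd numbers up to \<open>2 * k + 1\<close>: every
    crossing number lies among them, and all are admissible.\<close>
  define I where "I = (\<lambda>j. 2 * j + 1) ` {..k}"
  have I: "finite I" "card I = Suc k" by (auto simp: I_def card_image inj_on_def)
  obtain a where a: "\<And>p :: real poly. degree p \<le> k \<Longrightarrow> (\<Sum>i\<in>I. a i * poly p (real i)) = poly p 0"
    using lagrange_extrapolation[OF I, of 0] by blast
  have adm: "admissible A U i" if "i \<in> I" for i
    using that cA cB by (auto simp: admissible_def I_def)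
  have inside: "2 * card {e \<in> M. e \<subseteq> A} + crossing A M = 2 * k + 1" if "M \<in> perfect_matchings U" for M
    using card_eq_inside_crossing[OF fin that, of A] cA by simp
  have crI: "crossing A M \<in> I" if "M \<in> perfect_matchings U" for M
    using inside[OF that] unfolding I_def by (intro image_eqI[of _ _ "k - card {e \<in> M. e \<subseteq> A}"]) auto
  define F :: real where "F = fact (2 * k + 1) * fact (2 * k + 1)"
  have F: "F > 0" by (simp add: F_def)
  define c where "c = (\<lambda>M. a (crossing A M) * cross_weight A U (crossing A M) / F)"
  have conv: "(\<Sum>M\<in>perfect_matchings U. c M * g M) = (\<Sum>i\<in>I. a i * cross_sum A U i g) / F" for g
  proof -
    have "(\<Sum>i\<in>I. a i * cross_sum A U i g)
      = (\<Sum>i\<in>I. \<Sum>M\<in>perfect_matchings U. if crossing A M = i then a i * cross_weight A U i * g M else 0)"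
      by (simp add: cross_sum_def sum_distrib_left if_distrib mult.assoc cong: if_cong)
    also have "\<dots> = (\<Sum>M\<in>perfect_matchings U. \<Sum>i\<in>I. if crossing A M = i then a i * cross_weight A U i * g M else 0)"
      by (rule sum.swap)
    also have "\<dots> = (\<Sum>M\<in>perfect_matchings U. a (crossing A M) * cross_weight A U (crossing A M) * g M)"
      by (rule sum.cong) (use I crI in \<open>auto simp: sum.delta'\<close>)
    finally show ?thesis by (simp add: c_def sum_divide_distrib)
  qed
  have one: "cross_sum A U i (\<lambda>_. 1) = F" if "i \<in> I" for i
    using cross_sum_one[OF fin adm[OF that]] cA cB by (simp add: F_def)
  show thesis
  proof (rule that[of c])
    have "(\<Sum>M\<in>perfect_matchings U. c M) = (\<Sum>i\<in>I. a i * F) / F"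
      using conv[of "\<lambda>_. 1"] one by simp
    also have "\<dots> = (\<Sum>i\<in>I. a i * poly [:1:] (real i))" using F by (simp flip: sum_distrib_right)
    also have "\<dots> = 1" by (subst a) auto
    finally show "(\<Sum>M\<in>perfect_matchings U. c M) = 1" .
  next
    \<comment> \<open>The polynomial \<open>(2 * k + 1 - i) / 2\<close>, the number of inside edges
      at crossing number \<open>i\<close>.\<close>
    let ?p = "[:real k + 1 / 2, - 1 / 2:]"
    have "cross_sum A U i (\<lambda>M. real (card {e \<in> M. e \<subseteq> A})) = F * poly ?p (real i)" if i: "i \<in> I" for i
    proof -
      have "(\<Sum>M\<in>perfect_matchings U. if crossing A M = i then real (card {e \<in> M. e \<subseteq> A}) else 0)
        = (\<Sum>M\<in>perfect_matchings U. (if crossing A M = i then 1 else 0) * poly ?p (real i))"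
      proof (rule sum.cong)
        fix M assume M: "M \<in> perfect_matchings U"
        have "2 * real (card {e \<in> M. e \<subseteq> A}) + real (crossing A M) = 2 * real k + 1"
          using arg_cong[OF inside[OF M], of real] by simp
        thus "(if crossing A M = i then real (card {e \<in> M. e \<subseteq> A}) else 0)
          = (if crossing A M = i then 1 else 0) * poly ?p (real i)" by auto
      qed simp
      hence "cross_sum A U i (\<lambda>M. real (card {e \<in> M. e \<subseteq> A})) = cross_sum A U i (\<lambda>_. 1) * poly ?p (real i)"
        unfolding cross_sum_def by (simp only: sum_distrib_right mult.assoc)
      thus ?thesis using one[OF i] by simp
    qed
    hence "(\<Sum>M\<in>perfect_matchings U. c M * real (card {e \<in> M. e \<subseteq> A})) = (\<Sum>i\<in>I. F * (a i * poly ?p (real i))) / F"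
      unfolding conv by (simp add: mult.left_commute)
    also have "\<dots> = (\<Sum>i\<in>I. a i * poly ?p (real i))" using F by (simp flip: sum_distrib_left)
    also have "\<dots> = real k + 1 / 2" using k by (subst a) auto
    finally show "(\<Sum>M\<in>perfect_matchings U. c M * real (card {e \<in> M. e \<subseteq> A})) = real k + 1 / 2" .
  next
    show "\<forall>S g. finite S \<longrightarrow> card S \<le> k \<longrightarrow> (\<forall>M\<in>perfect_matchings U. g M \<ge> 0) \<longrightarrow>
      depends_at U S g \<longrightarrow> (\<Sum>M\<in>perfect_matchings U. c M * g M) \<ge> 0"
    proof (intro allI impI)
      fix S :: "'a set" and g :: "'a set set \<Rightarrow> real"
      assume S: "finite S" "card S \<le> k" and g0: "\<forall>M\<in>perfect_matchings U. g M \<ge> 0" and dep: "depends_at U S g"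
      obtain p :: "real poly" where p: "degree p \<le> card S" "poly p 0 \<ge> 0"
        "\<And>i. admissible A U i \<Longrightarrow> cross_sum A U i g = poly p (real i)"
        using cross_sum_poly[OF fin S(1) _ dep, of A] g0 by blast
      have "(\<Sum>i\<in>I. a i * cross_sum A U i g) = (\<Sum>i\<in>I. a i * poly p (real i))"
        using p(3) adm by simp
      also have "\<dots> = poly p 0" using p(1) S(2) by (intro a) simp
      finally show "(\<Sum>M\<in>perfect_matchings U. c M * g M) \<ge> 0" unfolding conv using p(2) F by simp
    qed
  qed
qed

section \<open>Permutations between matchings\<close>

text \<open>Edges are matched up one at a time. Two ground sets are allowed because the induction
  deletes different edges on the two sides.\<close>

lemma exists_bij_matchings:
  assumes "finite X" "finite Y" "card X = card Y"
    and "M \<subseteq> {e. e \<subseteq> X \<and> card e = 2}" "pairwise disjnt M"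
    and "M' \<subseteq> {e. e \<subseteq> Y \<and> card e = 2}" "pairwise disjnt M'" and "card M = card M'"
  shows "\<exists>f. bij_betw f X Y \<and> (`) f ` M = M'"
  using assms
proof (induction "card M" arbitrary: X Y M M')
  case 0
  have "finite {e. e \<subseteq> X \<and> card e = 2}" "finite {e. e \<subseteq> Y \<and> card e = 2}"
    using 0 by (auto intro: finite_subset[of _ "Pow X"] finite_subset[of _ "Pow Y"])
  hence "finite M" "finite M'" using 0 by (meson finite_subset)+
  hence "M = {}" "M' = {}" using 0(1) 0(9) by simp_all
  thus ?case using finite_same_card_bij[OF 0(2,3,4)] by simp
next
  case (Suc m)
  have fM: "finite M" "finite M'"
    using Suc.hyps(2) Suc.prems(8) by (metis card_ge_0_finite zero_less_Suc)+
  obtain e e' where e: "e \<in> M" and e': "e' \<in> M'"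
    using Suc.hyps(2) Suc.prems(8) by (metis card.empty ex_in_conv nat.distinct(1))
  obtain a b where ab: "e = {a, b}" "a \<noteq> b" using e Suc.prems(4) by (auto simp: card_2_iff)
  obtain c d where cd: "e' = {c, d}" "c \<noteq> d" using e' Suc.prems(6) by (auto simp: card_2_iff)
  have eX: "e \<subseteq> X" "e' \<subseteq> Y" using e e' Suc.prems(4,6) by auto
  have de: "f \<inter> e = {}" if "f \<in> M - {e}" for f
    using that e pairwiseD[OF Suc.prems(5), of f e] by (auto simp: disjnt_def)
  have de': "f \<inter> e' = {}" if "f \<in> M' - {e'}" for f
    using that e' pairwiseD[OF Suc.prems(7), of f e'] by (auto simp: disjnt_def)
  have "\<exists>f. bij_betw f (X - e) (Y - e') \<and> (`) f ` (M - {e}) = M' - {e'}"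
  proof (rule Suc.hyps(1))
    show "m = card (M - {e})" using Suc.hyps(2) e fM by simp
    show "card (M - {e}) = card (M' - {e'})" using Suc.prems(8) e e' fM by simp
    have "card (X - e) = card X - card e" "card (Y - e') = card Y - card e'"
      using eX ab cd by (auto intro!: card_Diff_subset)
    thus "card (X - e) = card (Y - e')" using Suc.prems(3) ab cd by simp
    show "M - {e} \<subseteq> {f. f \<subseteq> X - e \<and> card f = 2}" using Suc.prems(4) de by blast
    show "M' - {e'} \<subseteq> {f. f \<subseteq> Y - e' \<and> card f = 2}" using Suc.prems(6) de' by blast
    show "pairwise disjnt (M - {e})" "pairwise disjnt (M' - {e'})"
      using Suc.prems(5,7) by (auto intro: pairwise_subset)
  qed (use Suc.prems in auto)
  then obtain f where f: "bij_betw f (X - e) (Y - e')" "(`) f ` (M - {e}) = M' - {e'}" by blast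
  define g where "g = (\<lambda>x. if x = a then c else if x = b then d else f x)"
  have "bij_betw g e e'" using ab cd by (auto simp: bij_betw_def g_def)
  moreover have "bij_betw g (X - e) (Y - e')"
    using f(1) by (rule bij_betw_cong[THEN iffD1, rotated]) (auto simp: g_def ab)
  ultimately have "bij_betw g (e \<union> (X - e)) (e' \<union> (Y - e'))" by (rule bij_betw_combine) auto
  hence 1: "bij_betw g X Y" using eX by (simp add: Un_absorb1)
  have "g ` h = f ` h" if "h \<in> M - {e}" for h
    using de[OF that] ab by (intro image_cong) (auto simp: g_def)
  hence "(`) g ` (M - {e}) = (`) f ` (M - {e})" by (rule image_cong[OF refl])
  moreover have "g ` e = e'" using ab cd by (auto simp: g_def)
  moreover have "M = insert e (M - {e})" "M' = insert e' (M' - {e'})" using e e' by auto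
  ultimately have "(`) g ` M = M'" using f(2) by (metis image_insert)
  thus ?case using 1 by blast
qed

lemma card_edges_at_le:
  assumes "finite S" "pairwise disjnt M"
  shows "card (edges_at S M) \<le> card S"
proof -
  define f where "f = (\<lambda>e. SOME x. x \<in> e \<inter> S)"
  have f: "f e \<in> e \<inter> S" if "e \<in> edges_at S M" for e
    using that unfolding edges_at_def f_def by (intro someI_ex[of "\<lambda>x. x \<in> e \<inter> S"]) auto
  have "inj_on f (edges_at S M)"
  proof (rule inj_onI)
    fix e e' assume e: "e \<in> edges_at S M" "e' \<in> edges_at S M" "f e = f e'"
    hence "\<not> disjnt e e'" using f[of e] f[of e'] by (auto simp: disjnt_def)
    thus "e = e'" using e assms(2) by (auto simp: pairwise_def edges_at_def)
  qed
  thus ?thesis using f assms(1) by (intro card_inj_on_le) auto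
qed

text \<open>The common edges at \<open>S\<close> are fixed pointwise and the other edges are mapped
  onto each other away from \<open>S\<close>. Since \<open>card S < card M\<close>, some edge of
  \<open>M'\<close> misses \<open>S\<close>; swapping its ends preserves \<open>M'\<close> and
  corrects the sign if necessary.\<close>

lemma exists_even_perm_matchings:
  assumes "finite X" "finite S"
    and M: "M \<subseteq> {e. e \<subseteq> X \<and> card e = 2}" "pairwise disjnt M"
    and M': "M' \<subseteq> {e. e \<subseteq> X \<and> card e = 2}" "pairwise disjnt M'"
    and card: "card M = card M'" "card S < card M" and eq: "edges_at S M = edges_at S M'"
  shows "\<exists>p. p permutes X - S \<and> evenperm p \<and> (`) p ` M = M'"
proof -
  define F where "F = edges_at S M"
  have FM: "F \<subseteq> M" "F \<subseteq> M'" using eq by (auto simp: F_def edges_at_def)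
  have fM: "finite M" "finite M'"
    using card by (auto intro!: card_ge_0_finite)
  have cF: "card F < card M" using card_edges_at_le[OF assms(2) M(2)] card(2) by (simp add: F_def)
  \<comment> \<open>The ends of the edges in \<open>F\<close> are excluded too, so that a
    permutation of \<open>Y\<close> keeps these edges.\<close>
  define Y where "Y = X - S - \<Union>F"
  have inY: "N - F \<subseteq> {e. e \<subseteq> Y \<and> card e = 2}"
    if "N \<subseteq> {e. e \<subseteq> X \<and> card e = 2}" "pairwise disjnt N" "edges_at S N = F" for N
  proof
    fix e assume e: "e \<in> N - F"
    hence "e \<inter> S = {}" using that(3) by (auto simp: edges_at_def)
    moreover have "e \<inter> f = {}" if "f \<in> F" for f
    proof -
      have "f \<in> N" using that \<open>edges_at S N = F\<close> by (auto simp: edges_at_def)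
      thus ?thesis using e that pairwiseD[OF \<open>pairwise disjnt N\<close>, of e f] by (auto simp: disjnt_def)
    qed
    moreover have "e \<subseteq> X" "card e = 2" using e that(1) by auto
    ultimately show "e \<in> {e. e \<subseteq> Y \<and> card e = 2}" by (auto simp: Y_def)
  qed
  have "\<exists>f. bij_betw f Y Y \<and> (`) f ` (M - F) = M' - F"
  proof (rule exists_bij_matchings)
    show "finite Y" "finite Y" using assms(1) by (auto simp: Y_def)
    show "M - F \<subseteq> {e. e \<subseteq> Y \<and> card e = 2}" by (rule inY[OF M]) (simp add: F_def)
    show "M' - F \<subseteq> {e. e \<subseteq> Y \<and> card e = 2}" by (rule inY[OF M']) (simp add: F_def eq)
    show "pairwise disjnt (M - F)" "pairwise disjnt (M' - F)"
      using M(2) M'(2) by (auto intro: pairwise_subset)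
    show "card (M - F) = card (M' - F)"
      using FM fM card by (simp add: card_Diff_subset finite_subset)
  qed simp
  then obtain f where f: "bij_betw f Y Y" "(`) f ` (M - F) = M' - F" by blast
  define p where "p = (\<lambda>x. if x \<in> Y then f x else x)"
  have "bij_betw p Y Y" using f(1) by (rule bij_betw_cong[THEN iffD1, rotated]) (simp add: p_def)
  hence pY: "p permutes Y" by (rule bij_imp_permutes) (simp add: p_def)
  have YX: "Y \<subseteq> X - S" by (auto simp: Y_def)
  have pX: "p permutes X - S" using pY YX by (rule permutes_subset)
  have pM: "(`) p ` M = M'"
  proof -
    have "p ` e = e" if "e \<in> F" for e
    proof -
      have "p x = x" if "x \<in> e" for x using that \<open>e \<in> F\<close> by (auto simp: p_def Y_def)
      thus ?thesis by simp
    qed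
    moreover have "p ` e = f ` e" if "e \<in> M - F" for e
      using inY[OF M] that by (intro image_cong) (auto simp: F_def p_def)
    ultimately have "(`) p ` F = F" "(`) p ` (M - F) = M' - F" using f(2) by (force, force)
    moreover have "M = F \<union> (M - F)" "M' = F \<union> (M' - F)" using FM by auto
    ultimately show ?thesis by (metis image_Un)
  qed
  show ?thesis
  proof (cases "evenperm p")
    case True thus ?thesis using pX pM by blast
  next
    case False
    have "card (M' - F) > 0" using cF card(1) FM fM by (simp add: card_Diff_subset finite_subset)
    then obtain e where e: "e \<in> M' - F" by (metis all_not_in_conv card.empty less_irrefl)
    hence eY: "e \<subseteq> Y" "card e = 2" using inY[OF M'] by (auto simp: F_def eq)
    then obtain c d where cd: "e = {c, d}" "c \<noteq> d" by (auto simp: card_2_iff)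
    define t where "t = Transposition.transpose c d"
    have tX: "t permutes X - S"
      unfolding t_def using eY cd YX by (intro permutes_swap_id) auto
    have tM: "t ` h = h" if "h \<in> M'" for h
    proof (cases "h = e")
      case True thus ?thesis by (auto simp: t_def cd Transposition.transpose_def)
    next
      case False
      hence "disjnt h e" using that e M'(2) by (auto simp: pairwise_def)
      hence "c \<notin> h" "d \<notin> h" by (auto simp: cd disjnt_def)
      hence "t x = x" if "x \<in> h" for x using that by (auto simp: t_def Transposition.transpose_def)
      thus ?thesis by simp
    qed
    have "(`) (t \<circ> p) ` M = (`) t ` ((`) p ` M)" by (simp add: image_image image_comp)
    also have "\<dots> = M'" unfolding pM using tM by force
    finally have "(`) (t \<circ> p) ` M = M'" .
    moreover have "t \<circ> p permutes X - S" using pX tX by (rule permutes_compose)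
    moreover have "evenperm (t \<circ> p)"
    proof -
      have "permutation p" "permutation t" using pX tX assms(1) by (auto simp: permutation_permutes intro: exI[of _ "X - S"])
      thus ?thesis using False cd(2) by (simp add: evenperm_comp t_def evenperm_swap)
    qed
    ultimately show ?thesis by blast
  qed
qed

section \<open>Polytopes with an affine action of the alternating group\<close>

text \<open>The points \<open>s j\<close> may coincide, so the coefficients are first collected for
  each point.\<close>

lemma affine_index_sum:
  assumes "affine V" "finite J" "sum c J = 1" "\<And>j. j \<in> J \<Longrightarrow> s j \<in> V"
  shows "(\<Sum>j\<in>J. c j *\<^sub>R s j) \<in> V"
proof -
  have "(\<Sum>j\<in>J. c j *\<^sub>R s j) = (\<Sum>x\<in>s ` J. \<Sum>j\<in>{j \<in> J. s j = x}. c j *\<^sub>R s j)"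
    by (rule sum.image_gen[OF assms(2)])
  also have "\<dots> = (\<Sum>x\<in>s ` J. (\<Sum>j\<in>{j \<in> J. s j = x}. c j) *\<^sub>R x)"
    by (rule sum.cong) (auto simp: scaleR_sum_left)
  also have "\<dots> \<in> V"
  proof -
    have "(\<Sum>x\<in>s ` J. \<Sum>j\<in>{j \<in> J. s j = x}. c j) = 1"
      using sum.image_gen[OF assms(2), of c s] assms(3) by simp
    moreover have "s ` J \<noteq> {}" using assms(3) by auto
    ultimately show ?thesis
      using assms(2,4) by (intro assms(1)[unfolded affine, rule_format]) auto
  qed
  finally show ?thesis .
qed

lemma affine_map_sum:
  assumes "affine_map f" "sum c J = 1"
  shows "f (\<Sum>j\<in>J. c j *\<^sub>R s j) = (\<Sum>j\<in>J. c j *\<^sub>R f (s j))"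
proof -
  obtain L b where L: "linear L" "\<And>x. f x = L x + b" using assms(1) by (auto simp: affine_map_def)
  have "(\<Sum>j\<in>J. c j *\<^sub>R b) = b" using assms(2) by (simp flip: scaleR_sum_left)
  thus ?thesis using L by (simp add: linear_sum linear_cmul scaleR_add_right sum.distrib)
qed

lemma affine_map_facet:
  fixes f :: "'a::euclidean_space \<Rightarrow> 'a"
  assumes "affine_map f" "inj f" "F facet_of Q"
  shows "f ` F facet_of f ` Q"
proof -
  obtain L b where L: "linear L" "\<And>x. f x = L x + b" using assms(1) by (auto simp: affine_map_def)
  have inj: "inj L" using assms(2) by (auto simp: inj_def L)
  have im: "f ` S = (+) b ` L ` S" for S by (auto simp: L image_iff add.commute)
  obtain L' where L': "linear L'" "L' \<circ> L = id" using linear_injective_left_inverse[OF L(1) inj] by blast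
  have "aff_dim (L ` S) = aff_dim S" for S
  proof (rule antisym)
    show "aff_dim (L ` S) \<le> aff_dim S" by (rule aff_dim_linear_image_le[OF L(1)])
    have "aff_dim (L' ` L ` S) \<le> aff_dim (L ` S)" by (rule aff_dim_linear_image_le[OF L'(1)])
    thus "aff_dim S \<le> aff_dim (L ` S)" by (simp only: image_comp L'(2) image_id id_apply)
  qed
  thus ?thesis using assms(3) face_of_linear_image[OF L(1) inj]
    by (simp add: facet_of_def im aff_dim_translation_eq)
qed

text \<open>In an irredundant description by half-spaces every half-space cuts out a facet, so
  within the affine hull the facet inequalities suffice.\<close>

lemma mem_polyhedron_if_facets:
  fixes Q :: "'a::euclidean_space set"
  assumes "polyhedron Q" "y \<in> affine hull Q"
    and "\<And>a b. Q \<subseteq> {x. a \<bullet> x \<le> b} \<Longrightarrow> Q \<inter> {x. a \<bullet> x = b} facet_of Q \<Longrightarrow> a \<bullet> y \<le> b"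
  shows "y \<in> Q"
proof -
  obtain H where H: "finite H" "Q = affine hull Q \<inter> \<Inter>H"
    "\<forall>h\<in>H. \<exists>a b. a \<noteq> 0 \<and> h = {x. a \<bullet> x \<le> b}" "\<forall>H'. H' \<subset> H \<longrightarrow> Q \<subset> affine hull Q \<inter> \<Inter>H'"
    using assms(1) unfolding polyhedron_Int_affine_minimal by blast
  then obtain a b where ab: "\<And>h. h \<in> H \<Longrightarrow> a h \<noteq> 0 \<and> h = {x. a h \<bullet> x \<le> b h}" by metis
  have "y \<in> h" if h: "h \<in> H" for h
  proof -
    have "Q \<inter> {x. a h \<bullet> x = b h} facet_of Q"
      using facet_of_polyhedron_explicit[OF H(1,2) ab] H(4) h by blast
    moreover have "Q \<subseteq> {x. a h \<bullet> x \<le> b h}" using H(2) ab[OF h] h by blast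
    ultimately have "a h \<bullet> y \<le> b h" by (rule assms(3)[rotated])
    thus ?thesis using ab[OF h] by blast
  qed
  thus ?thesis using H(2) assms(2) by blast
qed

locale alt_invariant_polytope =
  fixes n :: nat and \<phi> :: "(nat \<Rightarrow> nat) \<Rightarrow> 'a::euclidean_space \<Rightarrow> 'a" and Q :: "'a set"
  assumes affine_action: "affine_action (alt_group n) \<phi>"
    and image_Q: "\<And>g. g \<in> carrier (alt_group n) \<Longrightarrow> \<phi> g ` Q = Q"
    and polytope_Q: "polytope Q" and n2: "n \<ge> 2"
begin

abbreviation G where "G \<equiv> carrier (alt_group n)"

lemma action_comp: "g \<in> G \<Longrightarrow> h \<in> G \<Longrightarrow> \<phi> (g \<circ> h) x = \<phi> g (\<phi> h x)"
  using group_action.composition_rule[of "alt_group n" UNIV \<phi> x g h] affine_action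
  by (simp add: affine_action_def alt_group_mult)

lemma action_id: "\<phi> id x = x"
  using group_action.id_eq_one[of "alt_group n" UNIV \<phi>] affine_action
  by (simp add: affine_action_def alt_group_one fun_eq_iff)

lemma affine_map: "g \<in> G \<Longrightarrow> affine_map (\<phi> g)"
  using affine_action by (simp add: affine_action_def)

lemma inj_action: "g \<in> G \<Longrightarrow> inj (\<phi> g)"
  using group_action.inj_prop[of "alt_group n" UNIV \<phi>] affine_action by (simp add: affine_action_def)

lemma action_mem: "g \<in> G \<Longrightarrow> x \<in> Q \<Longrightarrow> \<phi> g x \<in> Q"
  using image_Q by blast

lemma id_G: "id \<in> G" by (simp add: alt_group_carrier permutes_id)

lemma comp_G: "g \<in> G \<Longrightarrow> h \<in> G \<Longrightarrow> g \<circ> h \<in> G"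
  using group.is_monoid[OF alt_group_is_group] monoid.m_closed alt_group_mult by metis

lemma inv_G: "g \<in> G \<Longrightarrow> inv' g \<in> G" by (rule alt_group_inv_closed)

lemma G_inverses: "g \<in> G \<Longrightarrow> g \<circ> inv' g = id" "g \<in> G \<Longrightarrow> inv' g \<circ> g = id"
  using permutes_inv_o by (auto simp: alt_group_carrier)

lemma card_G: "2 * card G = fact n" using alt_group_card_carrier[OF n2] .

lemma finite_G: "finite G"
proof (rule card_ge_0_finite)
  show "card G > 0" using card_G fact_gt_zero[of n, where 'a = nat] by linarith
qed

lemma sum_comp_left: "h \<in> G \<Longrightarrow> (\<Sum>g\<in>G. f (h \<circ> g)) = (\<Sum>g\<in>G. f g)"
  by (rule sum.reindex_bij_witness[of _ "\<lambda>g. inv' h \<circ> g" "\<lambda>g. h \<circ> g"])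
    (auto simp: comp_G inv_G G_inverses simp flip: comp_assoc)

lemma sum_comp_right: "h \<in> G \<Longrightarrow> (\<Sum>g\<in>G. f (g \<circ> h)) = (\<Sum>g\<in>G. f g)"
  by (rule sum.reindex_bij_witness[of _ "\<lambda>g. g \<circ> inv' h" "\<lambda>g. g \<circ> h"])
    (auto simp: comp_G inv_G G_inverses comp_assoc)

definition average :: "((nat \<Rightarrow> nat) \<Rightarrow> 'a) \<Rightarrow> 'a" where
  "average f = (\<Sum>g\<in>G. (1 / card G) *\<^sub>R f g)"

lemma weights: "(\<Sum>g\<in>G. 1 / real (card G)) = 1"
  using finite_G id_G by auto

lemma average_mem: "(\<And>g. g \<in> G \<Longrightarrow> f g \<in> Q) \<Longrightarrow> average f \<in> Q"
  unfolding average_def using finite_G weights polytope_imp_convex[OF polytope_Q]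
  by (intro convex_sum) auto

lemma action_average: "h \<in> G \<Longrightarrow> \<phi> h (average f) = average (\<lambda>g. \<phi> h (f g))"
  unfolding average_def by (intro affine_map_sum affine_map weights)

definition stab :: "'a set \<Rightarrow> (nat \<Rightarrow> nat) set" where
  "stab F = {g \<in> G. \<phi> g ` F = F}"

lemma perm_group_stab: "perm_group {1..n} (stab F)"
proof
  show "p permutes {1..n}" if "p \<in> stab F" for p using that by (simp add: stab_def alt_group_carrier)
  show "id \<in> stab F" by (simp add: stab_def id_G action_id)
  show "p \<circ> q \<in> stab F" if "p \<in> stab F" "q \<in> stab F" for p q
  proof -
    have "\<phi> (p \<circ> q) ` F = \<phi> p ` \<phi> q ` F"
      unfolding image_image using that by (intro image_cong) (auto simp: stab_def action_comp)
    thus ?thesis using that comp_G by (simp add: stab_def)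
  qed
  show "inv' p \<in> stab F" if "p \<in> stab F" for p
  proof -
    have p: "p \<in> G" "\<phi> p ` F = F" using that by (auto simp: stab_def)
    have "\<phi> (inv' p) ` F = \<phi> (inv' p) ` \<phi> p ` F" using p(2) by simp
    also have "\<dots> = \<phi> (inv' p \<circ> p) ` F" using action_comp[OF inv_G[OF p(1)] p(1)] by (simp add: image_image)
    also have "\<dots> = F" using G_inverses(2)[OF p(1)] by (simp add: action_id)
    finally show ?thesis using inv_G[OF p(1)] by (simp add: stab_def)
  qed
qed simp

text \<open>Orbit counting: the orbit of \<open>F\<close> consists of facets, and the elements with
  a given image of \<open>F\<close> form a coset of the stabiliser.\<close>

lemma card_G_le:
  assumes "F facet_of Q"
  shows "card G \<le> card {F. F facet_of Q} * card (stab F)"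
proof -
  let ?f = "\<lambda>g. \<phi> g ` F"
  have "?f ` G \<subseteq> {F. F facet_of Q}"
  proof safe
    fix g assume g: "g \<in> G"
    from affine_map_facet[OF affine_map[OF g] inj_action[OF g] assms]
    show "\<phi> g ` F facet_of Q" using image_Q[OF g] by simp
  qed
  hence "card (?f ` G) \<le> card {F. F facet_of Q}"
    using finite_polytope_facets[OF polytope_Q] by (intro card_mono)
  moreover have "card G \<le> card (?f ` G) * card (stab F)"
  proof -
    have "card G = card (\<Union>E\<in>?f ` G. {g \<in> G. ?f g = E})"
      by (rule arg_cong[of _ _ card]) auto
    also have "\<dots> \<le> (\<Sum>E\<in>?f ` G. card {g \<in> G. ?f g = E})"
      by (rule card_UN_le) (simp add: finite_G)
    also have "\<dots> \<le> (\<Sum>E\<in>?f ` G. card (stab F))"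
    proof (rule sum_mono)
      fix E assume "E \<in> ?f ` G"
      then obtain h where h: "h \<in> G" "E = ?f h" by blast
      have "(\<lambda>g. inv' h \<circ> g) ` {g \<in> G. ?f g = E} \<subseteq> stab F"
      proof (intro image_subsetI)
        fix g assume "g \<in> {g \<in> G. ?f g = E}"
        hence g: "g \<in> G" "\<phi> g ` F = \<phi> h ` F" using h(2) by auto
        have "\<phi> (inv' h \<circ> g) ` F = \<phi> (inv' h) ` \<phi> g ` F"
          using action_comp[OF inv_G[OF h(1)] g(1)] by (simp add: image_image)
        also have "\<dots> = \<phi> (inv' h \<circ> h) ` F"
          using action_comp[OF inv_G[OF h(1)] h(1)] by (simp add: image_image g(2))
        also have "\<dots> = F" using G_inverses(2)[OF h(1)] by (simp add: action_id)
        finally show "inv' h \<circ> g \<in> stab F" using g h inv_G comp_G by (simp add: stab_def)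
      qed
      moreover have "inj_on (\<lambda>g. inv' h \<circ> g) {g \<in> G. ?f g = E}"
      proof (rule inj_onI)
        fix g g' assume "inv' h \<circ> g = inv' h \<circ> g'"
        hence "(h \<circ> inv' h) \<circ> g = (h \<circ> inv' h) \<circ> g'" by (simp only: comp_assoc)
        thus "g = g'" using G_inverses(1)[OF h(1)] by simp
      qed
      moreover have "finite (stab F)" using finite_G by (simp add: stab_def)
      ultimately show "card {g \<in> G. ?f g = E} \<le> card (stab F)" by (meson card_inj_on_le)
    qed
    finally show ?thesis by simp
  qed
  ultimately show ?thesis by (meson le_trans mult_le_mono1)
qed

text \<open>The slack of a facet is determined on the affine hull of the polytope by its values on the
  facet and at one point outside the facet; the latter can be chosen fixed under the group.\<close>

lemma slack_invariant:
  assumes Q: "Q \<subseteq> {x. a \<bullet> x \<le> b}" and F: "F = Q \<inter> {x. a \<bullet> x = b}" "F facet_of Q"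
    and g: "g \<in> stab F" and x: "x \<in> Q"
  shows "a \<bullet> \<phi> g x = a \<bullet> x"
proof -
  have gG: "g \<in> G" using g by (simp add: stab_def)
  have "F \<noteq> Q" using F(2) by (auto simp: facet_of_def)
  then obtain z0 where z0: "z0 \<in> Q" "z0 \<notin> F" using facet_of_imp_subset[OF F(2)] by blast
  \<comment> \<open>The barycentre of an orbit is fixed by the group. It stays off the facet because
    the summand for the identity has positive slack.\<close>
  define z where "z = average (\<lambda>h. \<phi> h z0)"
  have zQ: "z \<in> Q" unfolding z_def using z0 action_mem by (intro average_mem)
  have fixed: "\<phi> g z = z"
  proof -
    have "\<phi> g z = average (\<lambda>h. \<phi> (g \<circ> h) z0)"
      unfolding z_def action_average[OF gG] unfolding average_def
      by (rule sum.cong) (simp_all add: action_comp[OF gG])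
    also have "\<dots> = z" unfolding z_def average_def by (rule sum_comp_left[OF gG])
    finally show ?thesis .
  qed
  have "a \<bullet> z < b"
  proof -
    have "b - a \<bullet> z = (\<Sum>h\<in>G. (1 / card G) * (b - a \<bullet> \<phi> h z0))"
    proof -
      have "(\<Sum>h\<in>G. (1 / card G) * b) = b" 
        by (simp only: sum_distrib_right[symmetric] weights mult_1)
      thus ?thesis
        by (simp add: z_def average_def inner_sum_right right_diff_distrib sum_subtractf)
    qed
    also have "\<dots> > 0"
    proof (rule sum_pos2[OF finite_G id_G])
      have "card G > 0" using finite_G id_G by (auto simp: card_gt_0_iff)
      moreover have "a \<bullet> z0 < b" using z0 Q F(1) by force
      ultimately show "0 < 1 / real (card G) * (b - a \<bullet> \<phi> id z0)" by (simp add: action_id)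
      show "0 \<le> 1 / real (card G) * (b - a \<bullet> \<phi> h z0)" if "h \<in> G" for h
        using action_mem[OF that z0(1)] Q by auto
    qed
    finally show ?thesis by simp
  qed
  moreover have "affine hull F \<subseteq> {x. a \<bullet> x = b}"
    by (rule hull_minimal) (auto simp: F(1) affine_hyperplane)
  ultimately have "z \<notin> affine hull F" by auto
  hence "aff_dim (insert z F) = aff_dim Q" using F(2) by (simp add: aff_dim_insert facet_of_def)
  moreover have "insert z F \<subseteq> Q" using zQ F(1) by auto
  ultimately have hull: "affine hull (insert z F) = affine hull Q" using aff_dim_eq_full_gen by blast
  obtain L c where L: "linear L" "\<And>x. \<phi> g x = L x + c"
    using affine_map[OF gG] by (auto simp: affine_map_def)
  \<comment> \<open>Since \<open>\<phi> g\<close> is affine, the points whose slack it preserves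
    form an affine set, which contains \<open>F\<close> and \<open>z\<close>.\<close>
  have "affine hull (insert z F) \<subseteq> {x. a \<bullet> \<phi> g x = a \<bullet> x}"
  proof (rule hull_minimal)
    show "insert z F \<subseteq> {x. a \<bullet> \<phi> g x = a \<bullet> x}"
    proof safe
      show "a \<bullet> \<phi> g z = a \<bullet> z" by (simp add: fixed)
      fix y assume y: "y \<in> F"
      hence "\<phi> g y \<in> F" using g by (auto simp: stab_def)
      thus "a \<bullet> \<phi> g y = a \<bullet> y" using y F(1) by simp
    qed
    show "affine {x. a \<bullet> \<phi> g x = a \<bullet> x}"
      unfolding affine_def
    proof (intro ballI allI impI CollectI)
      fix x y and u v :: real assume xy: "x \<in> {x. a \<bullet> \<phi> g x = a \<bullet> x}" "y \<in> {x. a \<bullet> \<phi> g x = a \<bullet> x}"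
        and uv: "u + v = 1"
      have "\<phi> g (u *\<^sub>R x + v *\<^sub>R y) = u *\<^sub>R \<phi> g x + v *\<^sub>R \<phi> g y + (1 - (u + v)) *\<^sub>R c"
        by (simp add: L linear_add linear_cmul algebra_simps)
      thus "a \<bullet> \<phi> g (u *\<^sub>R x + v *\<^sub>R y) = a \<bullet> (u *\<^sub>R x + v *\<^sub>R y)"
        using xy uv by (simp add: inner_add_right)
    qed
  qed
  moreover have "x \<in> affine hull Q" using x by (rule hull_inc)
  ultimately show ?thesis using hull by auto
qed

lemma stab_contains_alternating:
  assumes "n \<ge> 10" "4 * k + 2 \<le> n" "card {F. F facet_of Q} < n choose k" "F facet_of Q"
  shows "\<exists>T\<subseteq>{1..n}. card T \<le> k \<and> (\<forall>p. p permutes {1..n} - T \<longrightarrow> evenperm p \<longrightarrow> p \<in> stab F)"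
proof -
  interpret S: perm_group "{1..n}" "stab F" by (rule perm_group_stab)
  have "card (stab F) > 0" using S.finite_H S.id_mem by (auto simp: card_gt_0_iff)
  hence "card {F. F facet_of Q} * card (stab F) < (n choose k) * card (stab F)"
    using assms(3) by simp
  hence "card G < (n choose k) * card (stab F)" using card_G_le[OF assms(4)] by (rule le_less_trans[rotated])
  hence "fact n < 2 * card (stab F) * (n choose k)"
    unfolding card_G[symmetric] by (simp add: mult.commute)
  thus ?thesis using S.contains_alternating_of_small_index[of k] assms(1,2) by simp
qed

text \<open>Each summand pulls the choice made for the moved matching back along \<open>g\<close>.
  Replacing \<open>g\<close> by \<open>g \<circ> h\<close> in the average shows equivariance,
  whatever the initial choice \<open>s0\<close>.\<close>

lemma equivariant_section:
  fixes \<M> :: "nat set set set"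
  assumes closed: "\<And>g M. g \<in> G \<Longrightarrow> M \<in> \<M> \<Longrightarrow> (`) g ` M \<in> \<M>"
    and s0: "\<And>M. M \<in> \<M> \<Longrightarrow> s0 M \<in> Q"
  defines "s \<equiv> \<lambda>M. average (\<lambda>g. \<phi> (inv' g) (s0 ((`) g ` M)))"
  shows "M \<in> \<M> \<Longrightarrow> s M \<in> Q" and "M \<in> \<M> \<Longrightarrow> h \<in> G \<Longrightarrow> s ((`) h ` M) = \<phi> h (s M)"
proof -
  show "s M \<in> Q" if "M \<in> \<M>" unfolding s_def
    using that closed s0 inv_G action_mem by (intro average_mem) blast
  show "s ((`) h ` M) = \<phi> h (s M)" if M: "M \<in> \<M>" and h: "h \<in> G"
  proof -
    have im: "(`) (g \<circ> h) ` M = (`) g ` (`) h ` M" for g by (simp add: image_image comp_def)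
    have "s ((`) h ` M) = average (\<lambda>g. \<phi> h (\<phi> (inv' (g \<circ> h)) (s0 ((`) (g \<circ> h) ` M))))"
      unfolding s_def average_def
    proof (rule sum.cong)
      fix g assume g: "g \<in> G"
      have "bij g" "bij h" using g h by (auto simp: alt_group_carrier permutes_bij)
      hence "inv' (g \<circ> h) = inv' h \<circ> inv' g" by (rule o_inv_distrib)
      hence "h \<circ> inv' (g \<circ> h) = inv' g" using G_inverses(1)[OF h] by (simp flip: comp_assoc)
      hence "\<phi> h (\<phi> (inv' (g \<circ> h)) y) = \<phi> (inv' g) y" for y
        using action_comp[OF h inv_G[OF comp_G[OF g h]]] by metis
      thus "(1 / real (card G)) *\<^sub>R \<phi> (inv' g) (s0 ((`) g ` (`) h ` M)) =
        (1 / real (card G)) *\<^sub>R \<phi> h (\<phi> (inv' (g \<circ> h)) (s0 ((`) (g \<circ> h) ` M)))"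
        by (simp only: im)
    qed simp
    also have "\<dots> = average (\<lambda>g. \<phi> h (\<phi> (inv' g) (s0 ((`) g ` M))))"
      unfolding average_def by (rule sum_comp_right[OF h])
    also have "\<dots> = \<phi> h (s M)" unfolding s_def action_average[OF h] ..
    finally show ?thesis .
  qed
qed

end

section \<open>The matching polytope\<close>

lemma matching_image:
  assumes "matching n M" "g permutes {1..n}"
  shows "matching n ((`) g ` M)" "card ((`) g ` M) = card M"
proof -
  have inj: "inj g" using assms(2) by (rule permutes_inj)
  have im: "inj ((`) g)" using inj by (auto simp: inj_def inj_image_eq_iff)
  show "card ((`) g ` M) = card M" by (rule card_image) (use im in \<open>auto intro: inj_on_subset\<close>)
  have "g ` e \<in> complete_edges n" if "e \<in> complete_edges n" for e
  proof -
    have "g ` e \<subseteq> g ` {1..n}" using that by (auto simp: complete_edges_def)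
    hence "g ` e \<subseteq> {1..n}" using permutes_image[OF assms(2)] by simp
    moreover have "card (g ` e) = card e" by (rule card_image[OF inj_on_subset[OF inj subset_UNIV]])
    ultimately show ?thesis using that by (simp add: complete_edges_def)
  qed
  moreover have "disjnt (g ` e) (g ` f) \<longleftrightarrow> disjnt e f" for e f
    using inj by (auto simp: disjnt_def inj_def)
  hence "pairwise disjnt ((`) g ` M)"
    using assms(1) unfolding matching_def pairwise_def by blast
  ultimately show "matching n ((`) g ` M)"
    using assms(1) unfolding matching_def by blast
qed

lemma edge_action_char_vector:
  assumes "bij_betw ends UNIV (complete_edges n)" "g permutes {1..n}"
  shows "edge_action ends g (char_vector ends M) = char_vector ends ((`) g ` M)"
proof -
  have bij: "bij g" using assms(2) by (rule permutes_bij)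
  have "g -` ends e \<in> M \<longleftrightarrow> ends e \<in> (`) g ` M" for e
  proof
    assume "g -` ends e \<in> M"
    moreover have "g ` (g -` ends e) = ends e" using bij by (simp add: bij_is_surj surj_image_vimage_eq)
    ultimately show "ends e \<in> (`) g ` M" by (metis imageI)
  qed (use bij in \<open>auto simp: bij_is_inj inj_vimage_image_eq\<close>)
  moreover have "ends (inv_into UNIV ends (g -` ends e)) = g -` ends e" for e
  proof (rule f_inv_into_f)
    have e: "ends e \<in> complete_edges n" using assms(1) by (auto simp: bij_betw_def)
    have "card (g -` ends e) = card (ends e)" using bij by (intro card_vimage_inj) (auto simp: bij_is_inj bij_is_surj)
    moreover have "g -` ends e \<subseteq> {1..n}"
    proof
      fix t assume "t \<in> g -` ends e"
      hence "g t \<in> {1..n}" using e by (auto simp: complete_edges_def)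
      thus "t \<in> {1..n}" using permutes_in_image[OF assms(2)] by simp
    qed
    ultimately have "g -` ends e \<in> complete_edges n" using e by (simp add: complete_edges_def)
    thus "g -` ends e \<in> range ends" using assms(1) by (simp add: bij_betw_def)
  qed
  ultimately show ?thesis by (simp add: edge_action_def char_vector_def vec_eq_iff)
qed

lemma inner_char_vector:
  assumes "bij_betw ends UNIV (complete_edges n)" "M \<subseteq> complete_edges n"
  shows "(\<chi> e. if ends e \<subseteq> V then 1 else 0) \<bullet> char_vector ends M = real (card {e \<in> M. e \<subseteq> V})"
proof -
  have "(\<chi> e. if ends e \<subseteq> V then 1 else 0) \<bullet> char_vector ends M
    = (\<Sum>e\<in>UNIV. if ends e \<in> M \<and> ends e \<subseteq> V then 1 else 0)"
    unfolding inner_vec_def by (rule sum.cong) (auto simp: char_vector_def)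
  also have "\<dots> = real (card {e. ends e \<in> M \<and> ends e \<subseteq> V})" by (simp add: sum.If_cases)
  also have "card {e. ends e \<in> M \<and> ends e \<subseteq> V} = card (ends ` {e. ends e \<in> M \<and> ends e \<subseteq> V})"
    using assms(1) by (intro card_image[symmetric]) (auto simp: bij_betw_def intro: inj_on_subset)
  also have "ends ` {e. ends e \<in> M \<and> ends e \<subseteq> V} = {e \<in> M. e \<subseteq> V}"
  proof (intro equalityI subsetI)
    fix f assume f: "f \<in> {e \<in> M. e \<subseteq> V}"
    hence "f \<in> range ends" using assms by (auto simp: bij_betw_def)
    then obtain e where "f = ends e" by blast
    thus "f \<in> ends ` {e. ends e \<in> M \<and> ends e \<subseteq> V}" using f by auto
  qed auto
  finally show ?thesis .
qed

lemma card_edges_inside_le: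
  assumes "matching n M" "finite V"
  shows "2 * card {e \<in> M. e \<subseteq> V} \<le> card V"
proof -
  let ?N = "{e \<in> M. e \<subseteq> V}"
  have two: "card e = 2" if "e \<in> ?N" for e using that assms(1) by (auto simp: matching_def complete_edges_def)
  have "card (\<Union>?N) = sum card ?N"
    using assms by (intro card_Union_disjoint) (auto simp: matching_def pairwise_def intro: finite_subset)
  also have "\<dots> = 2 * card ?N" using two by simp
  finally have "2 * card ?N = card (\<Union>?N)" by simp
  also have "\<dots> \<le> card V" using assms(2) by (intro card_mono) auto
  finally show ?thesis .
qed

text \<open>Serves \<open>k = 0\<close>, where the claimed bound is \<open>1\<close>. Two different
  matchings lie below \<open>Q\<close>, so \<open>Q\<close> has positive dimension. The edge
  \<open>{5, 6}\<close> in \<open>R\<close> pads them when \<open>l = 2\<close>.\<close>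

lemma exists_facet_of_symmetric_extension:
  assumes "n \<ge> 10" "l = 1 \<or> l = 2" "bij_betw ends UNIV (complete_edges n)"
    "polytope Q" "linear p" "p ` Q = matching_polytope ends n l"
  shows "\<exists>F. F facet_of Q"
proof -
  define R :: "nat set set" where "R = (if l = 1 then {} else {{5, 6}})"
  define M where "M = (\<lambda>e. insert e R)"
  have mat: "matching n (M e) \<and> card (M e) = l" if "e = {1, 2} \<or> e = {3, 4}" for e
    using that assms(1,2)
    by (auto simp: M_def R_def matching_def complete_edges_def pairwise_def disjnt_def card_insert_if doubleton_eq_iff)
  have mem: "char_vector ends (M e) \<in> p ` Q" if "e = {1, 2} \<or> e = {3, 4}" for e
    unfolding assms(6) matching_polytope_def by (rule hull_inc) (use mat[OF that] in blast)
  have "{1, 2} \<in> complete_edges n" using assms(1) by (auto simp: complete_edges_def)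
  then obtain e where e: "ends e = {1, 2}" using assms(3) by (metis bij_betw_imp_surj_on imageE)
  have "char_vector ends (M {1, 2}) $ e \<noteq> char_vector ends (M {3, 4}) $ e"
    by (auto simp: char_vector_def e M_def R_def doubleton_eq_iff)
  hence ne: "char_vector ends (M {1, 2}) \<noteq> char_vector ends (M {3, 4})" by auto
  have "aff_dim Q > 0"
  proof (rule ccontr)
    assume "\<not> ?thesis"
    hence "aff_dim Q = -1 \<or> aff_dim Q = 0" using aff_dim_geq[of Q] by linarith
    hence "Q = {} \<or> (\<exists>a. Q = {a})" by (simp add: aff_dim_empty aff_dim_eq_0)
    thus False using mem[of "{1, 2}"] mem[of "{3, 4}"] ne by auto
  qed
  thus ?thesis using polytope_facet_exists[OF assms(4)] by blast
qed

theorem theorem5p3: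
  fixes n l :: nat
    and ends :: "'e::finite \<Rightarrow> nat set"
    and Q :: "(real ^ 'd::finite) set"
  assumes "n \<ge> 10"
    and "l \<ge> 1" and "2 * l \<le> n"
    and "bij_betw ends UNIV (complete_edges n)"
    and "symmetric_extension (alt_group n) (edge_action ends) (matching_polytope ends n l) Q"
  shows "card {F. F facet_of Q} \<ge> n choose ((l - 1) div 2)"
proof -
  define k where "k = (l - 1) div 2"
  define P where "P = matching_polytope ends n l"
  note ext = assms(5)[unfolded symmetric_extension_def, folded P_def]
  have poly: "polytope Q" using ext by (rule conjunct1)
  from conjunct2[OF ext] obtain \<phi> p
    where ext': "affine_action (alt_group n) \<phi> \<and> (\<forall>g\<in>carrier (alt_group n). \<phi> g ` Q = Q) \<and> linear p \<and> p ` Q = P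
      \<and> (\<forall>g\<in>carrier (alt_group n). \<forall>x\<in>Q. p (\<phi> g x) = edge_action ends g (p x))"
    by (elim exE)
  have act: "affine_action (alt_group n) \<phi>"
    and inv: "\<And>g. g \<in> carrier (alt_group n) \<Longrightarrow> \<phi> g ` Q = Q" and lin: "linear p" and pQ: "p ` Q = P"
    and eqv: "\<And>g x. g \<in> carrier (alt_group n) \<Longrightarrow> x \<in> Q \<Longrightarrow> p (\<phi> g x) = edge_action ends g (p x)"
    using ext' by blast+
  interpret alt_invariant_polytope n \<phi> Q
    by unfold_locales (use act inv poly assms(1) in auto)
  show ?thesis
  proof (cases "k = 0")
    case True
    hence "l = 1 \<or> l = 2" using assms(2) by (auto simp: k_def)
    then obtain F where "F facet_of Q"
      using exists_facet_of_symmetric_extension[OF assms(1) _ assms(4) poly lin pQ[unfolded P_def]] by blast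
    hence "card {F. F facet_of Q} > 0"
      using finite_polytope_facets[OF poly] by (auto simp: card_gt_0_iff)
    thus ?thesis using True by (simp add: k_def)
  next
    case False
    hence k1: "k \<ge> 1" by simp
    have l: "l = 2 * k + 1 \<or> l = 2 * k + 2" using assms(2) by (auto simp: k_def)
    have n4: "4 * k + 2 \<le> n" "l = 2 * k + 2 \<Longrightarrow> 4 * k + 4 \<le> n" using l assms(3) by auto
    show ?thesis
    proof (rule ccontr)
      assume "\<not> ?thesis"
      hence few: "card {F. F facet_of Q} < n choose k" by (simp add: k_def)
      define \<M> where "\<M> = {M. matching n M \<and> card M = l}"
      have closed: "(`) g ` M \<in> \<M>" if "g \<in> G" "M \<in> \<M>" for g M
        using that matching_image by (auto simp: \<M>_def alt_group_carrier)
      define s0 where "s0 = (\<lambda>M. SOME x. x \<in> Q \<and> p x = char_vector ends M)"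
      have s0: "s0 M \<in> Q \<and> p (s0 M) = char_vector ends M" if "M \<in> \<M>" for M
      proof -
        have "char_vector ends M \<in> p ` Q"
          unfolding pQ P_def matching_polytope_def by (rule hull_inc) (use that in \<open>auto simp: \<M>_def\<close>)
        thus ?thesis unfolding s0_def by (intro someI_ex[of "\<lambda>x. x \<in> Q \<and> p x = char_vector ends M"]) auto
      qed
      define s where "s = (\<lambda>M. average (\<lambda>g. \<phi> (inv' g) (s0 ((`) g ` M))))"
      have sQ: "s M \<in> Q" if "M \<in> \<M>" for M
        unfolding s_def by (rule equivariant_section(1)[of \<M>]) (use closed s0 that in auto)
      have s_eq: "s ((`) h ` M) = \<phi> h (s M)" if "M \<in> \<M>" "h \<in> G" for M h
        unfolding s_def by (rule equivariant_section(2)[of \<M>]) (use closed s0 that in auto)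
      \<comment> \<open>By equivariance of \<open>p\<close>, the map for \<open>inv' g\<close>
        brings the point above the moved matching back above \<open>M\<close>; averaging then
        changes nothing.\<close>
      have ps: "p (s M) = char_vector ends M" if M: "M \<in> \<M>" for M
      proof -
        have "p (s M) = (\<Sum>g\<in>G. (1 / card G) *\<^sub>R p (\<phi> (inv' g) (s0 ((`) g ` M))))"
          unfolding s_def average_def using lin by (simp add: linear_sum linear_cmul)
        also have "\<dots> = (\<Sum>g\<in>G. (1 / card G) *\<^sub>R char_vector ends M)"
        proof (rule sum.cong)
          fix g assume g: "g \<in> G"
          have "p (\<phi> (inv' g) (s0 ((`) g ` M))) = edge_action ends (inv' g) (char_vector ends ((`) g ` M))"
            using eqv[OF inv_G[OF g]] s0[OF closed[OF g M]] by simp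
          also have "\<dots> = char_vector ends ((`) (inv' g) ` (`) g ` M)"
            by (rule edge_action_char_vector[OF assms(4)]) (use inv_G[OF g] in \<open>simp add: alt_group_carrier\<close>)
          also have "(`) (inv' g) ` (`) g ` M = M"
          proof -
            have "inv' g ` g ` e = e" for e by (simp only: image_comp G_inverses(2)[OF g] image_id id_apply)
            thus ?thesis by (simp add: image_image)
          qed
          finally show "(1 / card G) *\<^sub>R p (\<phi> (inv' g) (s0 ((`) g ` M))) = (1 / card G) *\<^sub>R char_vector ends M"
            by simp
        qed simp
        also have "\<dots> = char_vector ends M" by (simp only: scaleR_sum_left[symmetric] weights scaleR_one)
        finally show ?thesis .
      qed
      define V :: "nat set" where "V = {1..2 * k + 1}"
      define U :: "nat set" where "U = {1..4 * k + 2}"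
      \<comment> \<open>Perfect matchings of \<open>U\<close> have \<open>2 * k + 1\<close> edges.
        For even \<open>l\<close> one fixed edge outside \<open>U\<close> is added;
        \<open>2 * l \<le> n\<close> leaves room for it.\<close>
      define R :: "nat set set" where "R = (if l = 2 * k + 1 then {} else {{4 * k + 3, 4 * k + 4}})"
      have UV: "U \<inter> V = V" "U - V = {2 * k + 2..4 * k + 2}" by (auto simp: U_def V_def)
      have card_UV: "card (U \<inter> V) = 2 * k + 1" "card (U - V) = 2 * k + 1" unfolding UV by (auto simp: V_def)
      have fU: "finite U" by (simp add: U_def)
      have RU: "e \<inter> U = {}" "e \<in> complete_edges n" if "e \<in> R" for e
        using that n4 l by (auto simp: R_def U_def complete_edges_def split: if_splits)
      have RV: "\<not> e \<subseteq> V" if "e \<in> R" for e using that by (auto simp: R_def V_def split: if_splits)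
      have cM: "M \<union> R \<in> \<M>" if M: "M \<in> perfect_matchings U" for M
      proof -
        have MU: "\<forall>e\<in>M. card e = 2" "pairwise disjnt M" "\<Union>M = U" using M by (auto simp: perfect_matchings_def)
        \<comment> \<open>With \<open>UNIV\<close> in the role of \<open>A\<close> nothing crosses,
          so the counting identity yields the number of edges of \<open>M\<close>.\<close>
        have "{e \<in> M. card (e \<inter> UNIV) = 1} = {}" using MU(1) by auto
        hence "crossing UNIV M = 0" unfolding crossing_def by (simp only: card.empty)
        hence "card M = 2 * k + 1"
          using card_eq_inside_crossing[OF fU M, of UNIV] by (simp add: U_def)
        moreover have "M \<inter> R = {}"
        proof -
          have "e = {}" if "e \<in> M" "e \<in> R" for e using that RU(1)[of e] MU(3) by auto
          thus ?thesis using MU(1) by fastforce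
        qed
        moreover have "finite M" by (rule finite_perfect_matching(1)[OF fU M])
        ultimately have "card (M \<union> R) = l" using l by (subst card_Un_disjoint) (auto simp: R_def)
        moreover have "U \<subseteq> {1..n}" using n4 by (auto simp: U_def)
        hence "M \<subseteq> complete_edges n" using MU(1,3) by (auto simp: complete_edges_def)
        hence "M \<union> R \<subseteq> complete_edges n" using RU(2) by blast
        moreover have "disjnt e f" "disjnt f e" if "e \<in> M" "f \<in> R" for e f
          using that RU(1)[of f] MU(3) by (auto simp: disjnt_def)
        hence "pairwise disjnt (M \<union> R)"
          using MU(2) by (auto simp: pairwise_def R_def)
        ultimately show ?thesis by (simp add: \<M>_def matching_def)
      qed
      obtain c :: "nat set set \<Rightarrow> real"
      where c1: "(\<Sum>M\<in>perfect_matchings U. c M) = 1"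
        and c2: "(\<Sum>M\<in>perfect_matchings U. c M * real (card {e \<in> M. e \<subseteq> V})) = real k + 1 / 2"
        and c3: "\<forall>S g. finite S \<longrightarrow> card S \<le> k \<longrightarrow> (\<forall>M\<in>perfect_matchings U. g M \<ge> 0) \<longrightarrow>
          depends_at U S g \<longrightarrow> (\<Sum>M\<in>perfect_matchings U. c M * g M) \<ge> 0"
        using matching_pseudo_expectation[OF fU card_UV k1] .
      \<comment> \<open>The coefficients may be negative, so convexity does not place
        \<open>y\<close> in \<open>Q\<close>; only the affine hull is immediate.\<close>
      define y where "y = (\<Sum>M\<in>perfect_matchings U. c M *\<^sub>R s (M \<union> R))"
      have "y \<in> Q"
      proof (rule mem_polyhedron_if_facets)
        show "polyhedron Q" using poly by (rule polytope_imp_polyhedron)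
        show "y \<in> affine hull Q" unfolding y_def
          using finite_perfect_matchings[OF fU] c1 sQ cM hull_inc[of _ Q affine]
          by (intro affine_index_sum affine_affine_hull) auto
        fix a b assume ab: "Q \<subseteq> {x. a \<bullet> x \<le> b}" and F: "Q \<inter> {x. a \<bullet> x = b} facet_of Q"
        obtain T where T: "T \<subseteq> {1..n}" "card T \<le> k"
          "\<And>q. q permutes {1..n} - T \<Longrightarrow> evenperm q \<Longrightarrow> q \<in> stab (Q \<inter> {x. a \<bullet> x = b})"
          using stab_contains_alternating[OF assms(1) n4(1) few F] by blast
        have fT: "finite T" using T(1) by (rule finite_subset) simp
        \<comment> \<open>As the coefficients sum to \<open>1\<close>, this is the slack of
          \<open>y\<close> itself.\<close>
        have "(\<Sum>M\<in>perfect_matchings U. c M * (b - a \<bullet> s (M \<union> R))) \<ge> 0"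
        proof (rule c3[rule_format, OF fT T(2)])
          show "b - a \<bullet> s (M \<union> R) \<ge> 0" if "M \<in> perfect_matchings U" for M
            using sQ[OF cM[OF that]] ab by auto
          show "depends_at U T (\<lambda>M. b - a \<bullet> s (M \<union> R))"
            unfolding depends_at_def
          proof (intro ballI impI)
            fix M M' assume M: "M \<in> perfect_matchings U" "M' \<in> perfect_matchings U"
              and eq: "edges_at T M = edges_at T M'"
            note m = cM[OF M(1)] cM[OF M(2)]
            have "edges_at T (N \<union> R) = edges_at T N \<union> edges_at T R" for N by (auto simp: edges_at_def)
            hence eq': "edges_at T (M \<union> R) = edges_at T (M' \<union> R)" using eq by simp
            \<comment> \<open>Guarantees an edge away from \<open>T\<close> for the correction of
              the sign.\<close>
            have "card T < l" using T(2) l by auto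
            hence "\<exists>q. q permutes {1..n} - T \<and> evenperm q \<and> (`) q ` (M \<union> R) = M' \<union> R"
              using m fT eq' by (intro exists_even_perm_matchings)
                (auto simp: \<M>_def matching_def complete_edges_def)
            then obtain q where q: "q permutes {1..n} - T" "evenperm q" "(`) q ` (M \<union> R) = M' \<union> R" by blast
            have qs: "q \<in> stab (Q \<inter> {x. a \<bullet> x = b})" using T(3) q by blast
            hence qG: "q \<in> G" by (simp add: stab_def)
            have "a \<bullet> s (M' \<union> R) = a \<bullet> \<phi> q (s (M \<union> R))" using s_eq[OF m(1) qG] q(3) by simp
            also have "\<dots> = a \<bullet> s (M \<union> R)" by (rule slack_invariant[OF ab refl F qs sQ[OF m(1)]])
            finally show "b - a \<bullet> s (M \<union> R) = b - a \<bullet> s (M' \<union> R)" by simp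
          qed
        qed
        also have "(\<Sum>M\<in>perfect_matchings U. c M * (b - a \<bullet> s (M \<union> R))) = b - a \<bullet> y"
        proof -
          have "(\<Sum>M\<in>perfect_matchings U. c M * b) = b" using c1 by (simp flip: sum_distrib_right)
          thus ?thesis by (simp add: y_def right_diff_distrib sum_subtractf inner_sum_right)
        qed
        finally show "a \<bullet> y \<le> b" by simp
      qed
      \<comment> \<open>The odd-set inequality for \<open>V\<close>: among \<open>2 * k + 1\<close>
        vertices a matching has at most \<open>k\<close> edges.\<close>
      define v :: "real ^ 'e" where "v = (\<chi> e. if ends e \<subseteq> V then 1 else 0)"
      have "P \<subseteq> {x. v \<bullet> x \<le> real k}"
        unfolding P_def matching_polytope_def
      proof (rule hull_minimal)
        show "{char_vector ends M |M. matching n M \<and> card M = l} \<subseteq> {x. v \<bullet> x \<le> real k}"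
        proof clarify
          fix M assume M: "matching n M"
          have "v \<bullet> char_vector ends M = real (card {e \<in> M. e \<subseteq> V})"
            unfolding v_def using M by (intro inner_char_vector[OF assms(4)]) (simp add: matching_def)
          moreover have "2 * card {e \<in> M. e \<subseteq> V} \<le> 2 * k + 1"
            using card_edges_inside_le[OF M, of V] by (simp add: V_def)
          ultimately show "v \<bullet> char_vector ends M \<le> real k" by simp
        qed
      qed (rule convex_halfspace_le)
      moreover have "p y \<in> P" using \<open>y \<in> Q\<close> pQ by blast
      ultimately have "v \<bullet> p y \<le> real k" by blast
      moreover have "v \<bullet> p y = real k + 1 / 2"
      proof -
        have "v \<bullet> p y = (\<Sum>M\<in>perfect_matchings U. c M * (v \<bullet> p (s (M \<union> R))))"
          unfolding y_def using lin by (simp add: linear_sum linear_cmul inner_sum_right)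
        also have "\<dots> = (\<Sum>M\<in>perfect_matchings U. c M * real (card {e \<in> M. e \<subseteq> V}))"
        proof (rule sum.cong)
          fix M assume M: "M \<in> perfect_matchings U"
          have "v \<bullet> char_vector ends (M \<union> R) = real (card {e \<in> M \<union> R. e \<subseteq> V})"
            unfolding v_def using cM[OF M] by (intro inner_char_vector[OF assms(4)]) (simp add: \<M>_def matching_def)
          moreover have "{e \<in> M \<union> R. e \<subseteq> V} = {e \<in> M. e \<subseteq> V}" using RV by auto
          ultimately show "c M * (v \<bullet> p (s (M \<union> R))) = c M * real (card {e \<in> M. e \<subseteq> V})"
            using ps[OF cM[OF M]] by simp
        qed simp
        finally show ?thesis using c2 by simp
      qed
      ultimately show False by simp
    qed
  qed
qed

end
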